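(* Let $\mathscr{A}$ be a $C^*$-algebra equipped with a $*$-conjugate-automorphism $\sharp$, let $\mathscr{E}$ be a right Hilbert $\mathscr{A}$-module, and let $\mathbb{L}_c(\mathscr{E})$ be the set of all $\sharp$-adjointable bounded conjugate-linear operators on $\mathscr{E}$. Equip $\mathbb{L}_c(\mathscr{E})$ with pointwise addition, the scalar multiplication $(\lambda\cdot T)(x):=\bar\lambda\,T(x)$ ($\lambda\in\mathbb{C}$, $x\in\mathscr{E}$), the right action of $\mathbb{L}(\mathscr{E})$ given by composition $(T,S)\mapsto TS$ ($T\in\mathbb{L}_c(\mathscr{E})$, $S\in\mathbb{L}(\mathscr{E})$), and $\langle S,T\rangle_c:=S^*T$ for $S,T\in\mathbb{L}_c(\mathscr{E})$, where $S^*$ is the $\sharp$-adjoint of $S$. Then $\mathbb{L}_c(\mathscr{E})$ is a Hilbert $\mathbb{L}(\mathscr{E})$-module, and the norm $\|T\|_c=\|\langle T,T\rangle_c\|^{1/2}$ induced by this inner product coincides with the operator norm of $T$.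
   Context: A $*$-conjugate-automorphism on a $C^*$-algebra $\mathscr{A}$ is a map $\sharp:\mathscr{A}\to\mathscr{A}$, $a\mapsto a^\sharp$, such that for all $a,b\in\mathscr{A}$, $\lambda\in\mathbb{C}$: (1) $(\lambda a+b)^\sharp=\bar\lambda a^\sharp+b^\sharp$; (2) $(a^\sharp)^\sharp=a$; (3) $(a^\sharp)^*=(a^* )^\sharp$; (4) $(ab)^\sharp=a^\sharp b^\sharp$. Inner products of right Hilbert $C^*$-modules are conjugate-linear in the first and linear in the second variable. $\mathbb{L}(\mathscr{E})$ is the $C^*$-algebra of adjointable linear operators on $\mathscr{E}$. A bounded conjugate-linear operator $S:\mathscr{E}\to\mathscr{E}$ is $\sharp$-adjointable if there is a bounded conjugate-linear operator $S^*:\mathscr{E}\to\mathscr{E}$ (its $\sharp$-adjoint) with $\langle Sx,y\rangle=\langle x,S^*y\rangle^\sharp$ for all $x,y\in\mathscr{E}$. *)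

theory Defs
  imports "HOL-Analysis.Analysis" "HOL-Library.Function_Algebras"
begin

section \<open>\<open>C\<^sup>*\<close>-algebras and right Hilbert modules on explicit carriers\<close>

text \<open>
  All structures live on carrier sets, because the algebra of adjointable operators and the module
  of conjugate-linear operators are sets of functions depending on the given module and hence are
  not types. Addition, zero and subtraction are those of the ambient type (pointwise for functions),
  which also carries the scalar multiplication; the other operations matter on the carrier only.
  Completeness is therefore stated directly: the library's metric space locale asks for a symmetric
  nonnegative distance on the whole type, and the norms here are unspecified off the carrier.
  Algebras need not be unital.
\<close>

definition norm_complete :: "'v::ab_group_add set \<Rightarrow> ('v \<Rightarrow> real) \<Rightarrow> bool" where
  "norm_complete V nrm \<longleftrightarrow>
     (\<forall>\<sigma> :: nat \<Rightarrow> 'v. range \<sigma> \<subseteq> V \<and> (\<forall>\<epsilon>>0. \<exists>N. \<forall>m\<ge>N. \<forall>n\<ge>N. nrm (\<sigma> m - \<sigma> n) < \<epsilon>)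
        \<longrightarrow> (\<exists>x\<in>V. (\<lambda>n. nrm (\<sigma> n - x)) \<longlonglongrightarrow> 0))"

record 'a cstar_struct =
  acarrier :: "'a set"
  ascale :: "complex \<Rightarrow> 'a \<Rightarrow> 'a"
  amult :: "'a \<Rightarrow> 'a \<Rightarrow> 'a" (infixl "\<odot>\<index>" 70)
  astar :: "'a \<Rightarrow> 'a"
  anorm :: "'a \<Rightarrow> real"

locale cstar_algebra = vector_space "ascale A" for A :: "'a::ab_group_add cstar_struct" (structure) +
  assumes carrier_subspace: "subspace (acarrier A)"
    and norm_nonneg: "a \<in> acarrier A \<Longrightarrow> 0 \<le> anorm A a"
    and norm_eq_zero_iff: "a \<in> acarrier A \<Longrightarrow> anorm A a = 0 \<longleftrightarrow> a = 0"
    and norm_triangle: "\<lbrakk>a \<in> acarrier A; b \<in> acarrier A\<rbrakk> \<Longrightarrow> anorm A (a + b) \<le> anorm A a + anorm A b"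
    and norm_scale: "a \<in> acarrier A \<Longrightarrow> anorm A (ascale A c a) = cmod c * anorm A a"
    and complete: "norm_complete (acarrier A) (anorm A)"
    and mult_closed: "\<lbrakk>a \<in> acarrier A; b \<in> acarrier A\<rbrakk> \<Longrightarrow> a \<odot> b \<in> acarrier A"
    and mult_assoc: "\<lbrakk>a \<in> acarrier A; b \<in> acarrier A; d \<in> acarrier A\<rbrakk> \<Longrightarrow> (a \<odot> b) \<odot> d = a \<odot> (b \<odot> d)"
    and mult_add_left: "\<lbrakk>a \<in> acarrier A; b \<in> acarrier A; d \<in> acarrier A\<rbrakk> \<Longrightarrow> (a + b) \<odot> d = a \<odot> d + b \<odot> d"
    and mult_add_right: "\<lbrakk>a \<in> acarrier A; b \<in> acarrier A; d \<in> acarrier A\<rbrakk> \<Longrightarrow> a \<odot> (b + d) = a \<odot> b + a \<odot> d"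
    and mult_scale_left: "\<lbrakk>a \<in> acarrier A; b \<in> acarrier A\<rbrakk> \<Longrightarrow> ascale A c a \<odot> b = ascale A c (a \<odot> b)"
    and mult_scale_right: "\<lbrakk>a \<in> acarrier A; b \<in> acarrier A\<rbrakk> \<Longrightarrow> a \<odot> ascale A c b = ascale A c (a \<odot> b)"
    and norm_mult: "\<lbrakk>a \<in> acarrier A; b \<in> acarrier A\<rbrakk> \<Longrightarrow> anorm A (a \<odot> b) \<le> anorm A a * anorm A b"
    and star_closed: "a \<in> acarrier A \<Longrightarrow> astar A a \<in> acarrier A"
    and star_star: "a \<in> acarrier A \<Longrightarrow> astar A (astar A a) = a"
    and star_add: "\<lbrakk>a \<in> acarrier A; b \<in> acarrier A\<rbrakk> \<Longrightarrow> astar A (a + b) = astar A a + astar A b"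
    and star_scale: "a \<in> acarrier A \<Longrightarrow> astar A (ascale A c a) = ascale A (cnj c) (astar A a)"
    and star_mult: "\<lbrakk>a \<in> acarrier A; b \<in> acarrier A\<rbrakk> \<Longrightarrow> astar A (a \<odot> b) = astar A b \<odot> astar A a"
    and cstar_identity: "a \<in> acarrier A \<Longrightarrow> anorm A (astar A a \<odot> a) = (anorm A a)\<^sup>2"

definition positive :: "'a cstar_struct \<Rightarrow> 'a \<Rightarrow> bool" where
  "positive A a \<longleftrightarrow> (\<exists>b\<in>acarrier A. a = astar A b \<odot>\<^bsub>A\<^esub> b)"

definition star_conj_automorphism :: "'a::ab_group_add cstar_struct \<Rightarrow> ('a \<Rightarrow> 'a) \<Rightarrow> bool" where
  "star_conj_automorphism A s \<longleftrightarrow>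
     (\<forall>a\<in>acarrier A. s a \<in> acarrier A) \<and>
     (\<forall>a\<in>acarrier A. \<forall>b\<in>acarrier A. \<forall>c. s (ascale A c a + b) = ascale A (cnj c) (s a) + s b) \<and>
     (\<forall>a\<in>acarrier A. s (s a) = a) \<and>
     (\<forall>a\<in>acarrier A. astar A (s a) = s (astar A a)) \<and>
     (\<forall>a\<in>acarrier A. \<forall>b\<in>acarrier A. s (a \<odot>\<^bsub>A\<^esub> b) = s a \<odot>\<^bsub>A\<^esub> s b)"

record ('a, 'e) hmod_struct =
  ecarrier :: "'e set"
  escale :: "complex \<Rightarrow> 'e \<Rightarrow> 'e"
  eact :: "'e \<Rightarrow> 'a \<Rightarrow> 'e"
  einner :: "'e \<Rightarrow> 'e \<Rightarrow> 'a"

definition enorm :: "'a cstar_struct \<Rightarrow> ('a, 'e) hmod_struct \<Rightarrow> 'e \<Rightarrow> real" where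
  "enorm A E x = sqrt (anorm A (einner E x x))"

locale hilbert_module = cstar_algebra A + E: vector_space "escale E"
  for A :: "'a::ab_group_add cstar_struct" (structure) and E :: "('a, 'e::ab_group_add) hmod_struct" +
  assumes ecarrier_subspace: "E.subspace (ecarrier E)"
    and act_closed: "\<lbrakk>x \<in> ecarrier E; a \<in> acarrier A\<rbrakk> \<Longrightarrow> eact E x a \<in> ecarrier E"
    and act_add_left: "\<lbrakk>x \<in> ecarrier E; y \<in> ecarrier E; a \<in> acarrier A\<rbrakk> \<Longrightarrow> eact E (x + y) a = eact E x a + eact E y a"
    and act_add_right: "\<lbrakk>x \<in> ecarrier E; a \<in> acarrier A; b \<in> acarrier A\<rbrakk> \<Longrightarrow> eact E x (a + b) = eact E x a + eact E x b"
    and act_mult: "\<lbrakk>x \<in> ecarrier E; a \<in> acarrier A; b \<in> acarrier A\<rbrakk> \<Longrightarrow> eact E x (a \<odot> b) = eact E (eact E x a) b"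
    and act_scale_left: "\<lbrakk>x \<in> ecarrier E; a \<in> acarrier A\<rbrakk> \<Longrightarrow> eact E (escale E c x) a = escale E c (eact E x a)"
    and act_scale_right: "\<lbrakk>x \<in> ecarrier E; a \<in> acarrier A\<rbrakk> \<Longrightarrow> eact E x (ascale A c a) = escale E c (eact E x a)"
    and inner_closed: "\<lbrakk>x \<in> ecarrier E; y \<in> ecarrier E\<rbrakk> \<Longrightarrow> einner E x y \<in> acarrier A"
    and inner_add_right: "\<lbrakk>x \<in> ecarrier E; y \<in> ecarrier E; z \<in> ecarrier E\<rbrakk> \<Longrightarrow> einner E x (y + z) = einner E x y + einner E x z"
    and inner_scale_right: "\<lbrakk>x \<in> ecarrier E; y \<in> ecarrier E\<rbrakk> \<Longrightarrow> einner E x (escale E c y) = ascale A c (einner E x y)"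
    and inner_act_right: "\<lbrakk>x \<in> ecarrier E; y \<in> ecarrier E; a \<in> acarrier A\<rbrakk> \<Longrightarrow> einner E x (eact E y a) = einner E x y \<odot> a"
    and inner_commute: "\<lbrakk>x \<in> ecarrier E; y \<in> ecarrier E\<rbrakk> \<Longrightarrow> einner E y x = astar A (einner E x y)"
    and inner_positive: "x \<in> ecarrier E \<Longrightarrow> positive A (einner E x x)"
    and inner_eq_zero: "\<lbrakk>x \<in> ecarrier E; einner E x x = 0\<rbrakk> \<Longrightarrow> x = 0"
    and ecomplete: "norm_complete (ecarrier E) (enorm A E)"

section \<open>Operators\<close>

text \<open>
  A map on the carrier is represented by the function that extends it by 0 to the ambient type.
  This makes the representation unique and is preserved by pointwise addition and composition.
\<close>

definition carrier_maps :: "('a, 'e::ab_group_add) hmod_struct \<Rightarrow> ('e \<Rightarrow> 'e) set" where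
  "carrier_maps E = {T. (\<forall>x\<in>ecarrier E. T x \<in> ecarrier E) \<and> (\<forall>x. x \<notin> ecarrier E \<longrightarrow> T x = 0)}"

definition linear_ops :: "('a, 'e::ab_group_add) hmod_struct \<Rightarrow> ('e \<Rightarrow> 'e) set" where
  "linear_ops E = {T \<in> carrier_maps E.
     \<forall>x\<in>ecarrier E. \<forall>y\<in>ecarrier E. \<forall>c. T (escale E c x + y) = escale E c (T x) + T y}"

definition conj_linear_ops :: "('a, 'e::ab_group_add) hmod_struct \<Rightarrow> ('e \<Rightarrow> 'e) set" where
  "conj_linear_ops E = {T \<in> carrier_maps E.
     \<forall>x\<in>ecarrier E. \<forall>y\<in>ecarrier E. \<forall>c. T (escale E c x + y) = escale E (cnj c) (T x) + T y}"

definition bounded_op :: "'a cstar_struct \<Rightarrow> ('a, 'e) hmod_struct \<Rightarrow> ('e \<Rightarrow> 'e) \<Rightarrow> bool" where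
  "bounded_op A E T \<longleftrightarrow> (\<exists>C. \<forall>x\<in>ecarrier E. enorm A E (T x) \<le> C * enorm A E x)"

definition op_norm :: "'a cstar_struct \<Rightarrow> ('a, 'e) hmod_struct \<Rightarrow> ('e \<Rightarrow> 'e) \<Rightarrow> real" where
  "op_norm A E T = (SUP x\<in>{x \<in> ecarrier E. enorm A E x \<le> 1}. enorm A E (T x))"

definition is_adjoint :: "('a, 'e::ab_group_add) hmod_struct \<Rightarrow> ('e \<Rightarrow> 'e) \<Rightarrow> ('e \<Rightarrow> 'e) \<Rightarrow> bool" where
  "is_adjoint E T R \<longleftrightarrow> R \<in> carrier_maps E \<and>
     (\<forall>x\<in>ecarrier E. \<forall>y\<in>ecarrier E. einner E (T x) y = einner E x (R y))"

definition is_sharp_adjoint ::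
  "'a cstar_struct \<Rightarrow> ('a \<Rightarrow> 'a) \<Rightarrow> ('a, 'e::ab_group_add) hmod_struct \<Rightarrow> ('e \<Rightarrow> 'e) \<Rightarrow> ('e \<Rightarrow> 'e) \<Rightarrow> bool"
where
  "is_sharp_adjoint A s E S R \<longleftrightarrow> R \<in> conj_linear_ops E \<and> bounded_op A E R \<and>
     (\<forall>x\<in>ecarrier E. \<forall>y\<in>ecarrier E. einner E (S x) y = s (einner E x (R y)))"

text \<open>
  Adjointable operators are not required to be bounded: boundedness is automatic.
\<close>

definition adjointable_algebra ::
  "'a cstar_struct \<Rightarrow> ('a, 'e::ab_group_add) hmod_struct \<Rightarrow> ('e \<Rightarrow> 'e) cstar_struct"
where
  "adjointable_algebra A E =
     \<lparr>acarrier = {T \<in> linear_ops E. \<exists>R. is_adjoint E T R},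
      ascale = (\<lambda>c T x. escale E c (T x)),
      amult = (\<circ>),
      astar = (\<lambda>T. THE R. is_adjoint E T R),
      anorm = op_norm A E\<rparr>"

definition sharp_adjointable_module ::
  "'a cstar_struct \<Rightarrow> ('a \<Rightarrow> 'a) \<Rightarrow> ('a, 'e::ab_group_add) hmod_struct \<Rightarrow> ('e \<Rightarrow> 'e, 'e \<Rightarrow> 'e) hmod_struct"
where
  "sharp_adjointable_module A s E =
     \<lparr>ecarrier = {S \<in> conj_linear_ops E. bounded_op A E S \<and> (\<exists>R. is_sharp_adjoint A s E S R)},
      escale = (\<lambda>c T x. escale E (cnj c) (T x)),
      eact = (\<circ>),
      einner = (\<lambda>S T. (THE R. is_sharp_adjoint A s E S R) \<circ> T)\<rparr>"

end

theory Submission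
  imports Defs
begin

text \<open>
  Everything about \<open>\<sharp>\<close>-adjointable operators is parallel to the adjointable case except the positivity of
  \<open>T\<^sup>*T\<close>, where \<open>T\<close> is not an element of the algebra \<open>\<L>(E)\<close>. It follows from
  \<open>\<langle>x, T\<^sup>*T x\<rangle> = \<langle>T x, T x\<rangle>\<^sup>\<sharp> \<ge> 0\<close> by looking at the negative part of \<open>T\<^sup>*T\<close>. The order on a unital
  \<open>C\<^sup>*\<close>-algebra is obtained without spectral theory: a self-adjoint \<open>a\<close> of norm at most 1 is a square if and
  only if \<open>\<parallel>1 - a\<parallel> \<le> 1\<close>. An algebra \<open>A\<close> without unit is embedded into \<open>\<L>(A)\<close> by left multiplication.
\<close>

section \<open>Square roots and order in \<open>C\<^sup>*\<close>-algebras\<close>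

text \<open>Positivity occurs in two forms. The module axioms speak of \<open>b\<^sup>* b\<close>,
  whereas sums, norm comparison and roots are controlled for squares of self-adjoint elements, since
  these can be recognised by their distance to the unit. That the first form implies the second is
  the hard fact about the order; the inner products of \<open>E\<close> are only given in the first
  form. The data also leave analytic facts to be derived: the axioms of \<sharp> do not mention the
  norm, so its isometry has to be extracted from the algebra; an operator with an adjoint must be
  bounded before the supremum defining its norm has a meaning; and a conjugate-linear operator
  composed with its adjoint is linear, so both kinds of operators need the same estimates side by
  side.\<close>

context cstar_algebra
begin

lemmas closed [simp, intro] =
  subspace_0[OF carrier_subspace] subspace_add[OF carrier_subspace] subspace_diff[OF carrier_subspace]
  subspace_scale[OF carrier_subspace] subspace_neg[OF carrier_subspace] mult_closed star_closed

lemma norm_zero [simp]: "anorm A 0 = 0"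
  using norm_eq_zero_iff[of 0] by auto

lemma norm_minus: "a \<in> acarrier A \<Longrightarrow> anorm A (- a) = anorm A a"
  using norm_scale[of a "-1"] by simp

lemma norm_diff: "\<lbrakk>a \<in> acarrier A; b \<in> acarrier A\<rbrakk> \<Longrightarrow> anorm A (a - b) \<le> anorm A a + anorm A b"
  using norm_triangle[of a "- b"] by (auto simp: norm_minus)

lemma norm_diff_commute: "\<lbrakk>a \<in> acarrier A; b \<in> acarrier A\<rbrakk> \<Longrightarrow> anorm A (a - b) = anorm A (b - a)"
  using norm_minus[of "a - b"] by simp

lemma mult_zero_left [simp]: "a \<in> acarrier A \<Longrightarrow> 0 \<odot> a = 0"
  using mult_scale_left[of a a 0] by simp

lemma mult_zero_right [simp]: "a \<in> acarrier A \<Longrightarrow> a \<odot> 0 = 0"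
  using mult_scale_right[of a a 0] by simp

lemma mult_minus_left: "\<lbrakk>a \<in> acarrier A; b \<in> acarrier A\<rbrakk> \<Longrightarrow> (- a) \<odot> b = - (a \<odot> b)"
  using mult_scale_left[of a b "-1"] by simp

lemma mult_minus_right: "\<lbrakk>a \<in> acarrier A; b \<in> acarrier A\<rbrakk> \<Longrightarrow> a \<odot> (- b) = - (a \<odot> b)"
  using mult_scale_right[of a b "-1"] by simp

lemma mult_diff_left: "\<lbrakk>a \<in> acarrier A; b \<in> acarrier A; d \<in> acarrier A\<rbrakk> \<Longrightarrow> (a - b) \<odot> d = a \<odot> d - b \<odot> d"
  using mult_add_left[of a "- b" d] by (auto simp: mult_minus_left)

lemma mult_diff_right: "\<lbrakk>a \<in> acarrier A; b \<in> acarrier A; d \<in> acarrier A\<rbrakk> \<Longrightarrow> a \<odot> (b - d) = a \<odot> b - a \<odot> d"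
  using mult_add_right[of a b "- d"] by (auto simp: mult_minus_right)

lemma star_zero [simp]: "astar A 0 = 0"
  using star_scale[of 0 0] by simp

lemma star_minus: "a \<in> acarrier A \<Longrightarrow> astar A (- a) = - astar A a"
  using star_scale[of a "-1"] by simp

lemma star_diff: "\<lbrakk>a \<in> acarrier A; b \<in> acarrier A\<rbrakk> \<Longrightarrow> astar A (a - b) = astar A a - astar A b"
  using star_add[of a "- b"] by (auto simp: star_minus)

lemmas distribs = mult_add_left mult_add_right mult_diff_left mult_diff_right mult_minus_left mult_minus_right
  mult_scale_left mult_scale_right mult_assoc

lemmas star_simps = star_add star_diff star_minus star_scale star_mult star_star

lemma norm_star:
  assumes a: "a \<in> acarrier A" shows "anorm A (astar A a) = anorm A a"
proof -
  have le: "anorm A b \<le> anorm A (astar A b)" if b: "b \<in> acarrier A" for b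
  proof (cases "anorm A b = 0")
    case False
    then have pos: "anorm A b > 0" using norm_nonneg[OF b] by simp
    have "anorm A b * anorm A b \<le> anorm A (astar A b) * anorm A b"
      using norm_mult[of "astar A b" b] cstar_identity[OF b] b by (auto simp: power2_eq_square)
    then show ?thesis using pos by simp
  qed (use b norm_nonneg in auto)
  show ?thesis using le[of a] le[of "astar A a"] a by (auto simp: star_star)
qed

lemma norm_selfadj_square:
  assumes "a \<in> acarrier A" "astar A a = a" shows "anorm A (a \<odot> a) = (anorm A a)\<^sup>2"
  using cstar_identity[OF assms(1)] assms(2) by simp

lemma selfadj_square_eq_0:
  assumes "a \<in> acarrier A" "astar A a = a" "a \<odot> a = 0" shows "a = 0"
  using norm_selfadj_square[OF assms(1,2)] assms norm_eq_zero_iff by simp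

lemma star_mult_eq_0:
  assumes "a \<in> acarrier A" "astar A a \<odot> a = 0" shows "a = 0"
  using cstar_identity[OF assms(1)] assms norm_eq_zero_iff by simp

text \<open>For passing to limits: the norm is a field of the record and induces no topology on the
  type, so an identity between limits is proved by dominating the norm of the difference by a null
  sequence.\<close>

lemma eq_if_norm_diff_null:
  assumes a: "a \<in> acarrier A" and b: "b \<in> acarrier A"
    and le: "\<And>n. anorm A (a - b) \<le> f n" and f: "f \<longlonglongrightarrow> (0::real)"
  shows "a = b"
proof -
  have "anorm A (a - b) \<le> 0" by (rule LIMSEQ_le_const[OF f]) (use le in auto)
  then show ?thesis using norm_nonneg[of "a - b"] norm_eq_zero_iff[of "a - b"] a b by auto
qed

text \<open>
  The element \<open>1 - w\<close> is a square root of \<open>1 - z\<close>, but no unit is needed to find \<open>w\<close>: it is the limit of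
  the iteration \<open>w\<^sub>n\<^sub>+\<^sub>1 = (z + w\<^sub>n\<^sup>2)/2\<close>, whose increments are dominated by those of the bounded increasing
  real sequence \<open>r\<^sub>n\<^sub>+\<^sub>1 = (1 + r\<^sub>n\<^sup>2)/2\<close>.
\<close>
lemma sqrt_one_minus:
  assumes z: "z \<in> acarrier A" "astar A z = z" "anorm A z \<le> 1"
  obtains w where "w \<in> acarrier A" "astar A w = w" "anorm A w \<le> 1" "w + w = z + w \<odot> w"
    "\<And>b. b \<in> acarrier A \<Longrightarrow> b \<odot> z = z \<odot> b \<Longrightarrow> b \<odot> w = w \<odot> b"
proof -
  define W where "W = rec_nat 0 (\<lambda>_ w. ascale A (1/2) (z + w \<odot> w))"
  define r where "r = rec_nat (0::real) (\<lambda>_ r. (1 + r\<^sup>2) / 2)"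
  have W0: "W 0 = 0" and WS: "W (Suc n) = ascale A (1/2) (z + W n \<odot> W n)" for n
    by (simp_all add: W_def)
  have r0: "r 0 = 0" and rS: "r (Suc n) = (1 + (r n)\<^sup>2) / 2" for n
    by (simp_all add: r_def)
  have Wc [simp]: "W n \<in> acarrier A" for n
    by (induction n) (auto simp: W0 WS z)
  have Wstar: "astar A (W n) = W n" for n
    by (induction n) (auto simp: W0 WS z star_simps)
  have Wcomm: "b \<odot> W n = W n \<odot> b" if b: "b \<in> acarrier A" "b \<odot> z = z \<odot> b" for b n
  proof (induction n)
    case (Suc n)
    have "b \<odot> (W n \<odot> W n) = (W n \<odot> W n) \<odot> b"
      using b Suc by (metis Wc mult_assoc)
    then show ?case using b z by (simp add: WS distribs)
  qed (simp add: W0 b)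
  have r01: "0 \<le> r n \<and> r n \<le> 1" for n
  proof (induction n)
    case (Suc n)
    then show ?case by (simp add: rS power_le_one)
  qed (simp add: r0)
  have W_le: "anorm A (W n) \<le> r n" for n
  proof (induction n)
    case (Suc n)
    have "anorm A (z + W n \<odot> W n) \<le> anorm A z + anorm A (W n) * anorm A (W n)"
      using norm_triangle[of z "W n \<odot> W n"] norm_mult[of "W n" "W n"] z by auto
    also have "\<dots> \<le> 1 + r n * r n"
      using z(3) mult_mono[OF Suc Suc] r01[of n] norm_nonneg[OF Wc[of n]] by auto
    finally show ?case using z by (simp add: WS rS norm_scale power2_eq_square)
  qed (simp add: W0 r0)
  have W_step: "anorm A (W (Suc n) - W n) \<le> r (Suc n) - r n" for n
  proof (induction n)
    case 0
    show ?case using z by (simp add: WS W0 r0 rS norm_scale)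
  next
    case (Suc n)
    let ?a = "W (Suc n)" and ?b = "W n"
    have "?a \<odot> ?a - ?b \<odot> ?b = ?a \<odot> (?a - ?b) + (?a - ?b) \<odot> ?b"
      by (simp add: distribs)
    also have "anorm A \<dots> \<le> anorm A ?a * anorm A (?a - ?b) + anorm A (?a - ?b) * anorm A ?b"
      using norm_triangle[of "?a \<odot> (?a - ?b)" "(?a - ?b) \<odot> ?b"] norm_mult[of ?a "?a - ?b"]
        norm_mult[of "?a - ?b" ?b] by simp
    also have "\<dots> \<le> r (Suc n) * (r (Suc n) - r n) + (r (Suc n) - r n) * r n"
      using Suc W_le[of n] W_le[of "Suc n"] r01 norm_nonneg[of "?a - ?b"] norm_nonneg[of ?a] norm_nonneg[of ?b]
      by (intro add_mono mult_mono) (auto intro: order_trans)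
    finally have "anorm A (?a \<odot> ?a - ?b \<odot> ?b) \<le> (r (Suc n))\<^sup>2 - (r n)\<^sup>2"
      by (simp add: power2_eq_square algebra_simps)
    moreover have "W (Suc (Suc n)) - W (Suc n) = ascale A (1/2) (?a \<odot> ?a - ?b \<odot> ?b)"
      unfolding WS[of "Suc n"] using WS[of n] by (simp add: algebra_simps)
    then have "anorm A (W (Suc (Suc n)) - W (Suc n)) = anorm A (?a \<odot> ?a - ?b \<odot> ?b) / 2"
      by (simp add: norm_scale)
    moreover have "r (Suc (Suc n)) - r (Suc n) = ((r (Suc n))\<^sup>2 - (r n)\<^sup>2) / 2"
      unfolding rS[of "Suc n"] by (subst (2) rS) (simp add: diff_divide_distrib add_divide_distrib)
    ultimately show ?case by simp
  qed
  have r_mono: "r n \<le> r (Suc n)" for n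
    using W_step[of n] norm_nonneg[of "W (Suc n) - W n"] by simp
  have W_diff: "anorm A (W (n + k) - W n) \<le> r (n + k) - r n" for n k
  proof (induction k)
    case (Suc k)
    have "W (n + Suc k) - W n = (W (Suc (n + k)) - W (n + k)) + (W (n + k) - W n)" by simp
    then show ?case
      using norm_triangle[of "W (Suc (n + k)) - W (n + k)" "W (n + k) - W n"] Suc W_step[of "n + k"] by simp
  qed simp
  have "incseq r" by (rule incseq_SucI) (rule r_mono)
  then have "convergent r"
    by (metis Bseq_eq_bounded Bseq_monoseq_convergent bounded_subset atLeastAtMost_iff bounded_closed_interval
        image_subset_iff incseq_imp_monoseq r01)
  then have "Cauchy r" by (rule convergent_Cauchy)
  have "norm_complete (acarrier A) (anorm A)" by (rule complete)
  moreover have "\<exists>N. \<forall>m\<ge>N. \<forall>n\<ge>N. anorm A (W m - W n) < \<epsilon>" if e: "\<epsilon> > 0" for \<epsilon>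
  proof -
    obtain N where N: "\<forall>m\<ge>N. \<forall>n\<ge>N. \<bar>r m - r n\<bar> < \<epsilon>"
      using \<open>Cauchy r\<close> e unfolding Cauchy_def dist_real_def by blast
    have "anorm A (W m - W n) < \<epsilon>" if "m \<ge> N" "n \<ge> N" for m n
    proof (cases "n \<le> m")
      case True
      then show ?thesis using W_diff[of n "m - n"] N that by fastforce
    next
      case False
      then show ?thesis using W_diff[of m "n - m"] N that norm_diff_commute[of "W m" "W n"] by fastforce
    qed
    then show ?thesis by blast
  qed
  ultimately obtain w where w [simp]: "w \<in> acarrier A" and lim: "(\<lambda>n. anorm A (W n - w)) \<longlonglongrightarrow> 0"
    unfolding norm_complete_def by (metis Wc image_subsetI)
  have lim': "(\<lambda>n. c * anorm A (W n - w)) \<longlonglongrightarrow> 0" for c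
    using tendsto_mult_left[OF lim, of c] by simp
  have "anorm A w \<le> 1"
  proof (rule LIMSEQ_le_const)
    show "(\<lambda>n. 1 + anorm A (W n - w)) \<longlonglongrightarrow> 1" using tendsto_add[OF tendsto_const lim, of 1] by simp
    have "anorm A w \<le> 1 + anorm A (W n - w)" for n
      using norm_diff[of "W n" "W n - w"] W_le[of n] r01[of n] by simp
    then show "\<exists>N. \<forall>n\<ge>N. anorm A w \<le> 1 + anorm A (W n - w)" by blast
  qed
  moreover have "astar A w = w"
  proof (rule eq_if_norm_diff_null[OF _ _ _ lim'[of 2]])
    fix n
    have eq: "astar A w - w = (W n - w) - astar A (W n - w)" by (simp add: star_simps Wstar)
    show "anorm A (astar A w - w) \<le> 2 * anorm A (W n - w)"
      unfolding eq using norm_diff[of "W n - w" "astar A (W n - w)"] by (simp add: norm_star)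
  qed auto
  moreover have "w + w = z + w \<odot> w"
  proof (rule eq_if_norm_diff_null[where f = "\<lambda>n. 2 * anorm A (W n - w) + 2 * anorm A (W (Suc n) - w)"])
    fix n
    have W2: "W (Suc n) + W (Suc n) = z + W n \<odot> W n"
      using scale_left_distrib[of "1/2" "1/2" "z + W n \<odot> W n"] by (simp add: WS)
    \<comment> \<open>The recursion for \<open>W (Suc n)\<close> is subtracted from the equation for
      \<open>w\<close>. What remains has in every term a factor \<open>W n - w\<close> or
      \<open>W (Suc n) - w\<close>.\<close>
    have "w + w - (z + w \<odot> w) = (W n \<odot> (W n - w) + (W n - w) \<odot> w) - ((W (Suc n) - w) + (W (Suc n) - w))"
      using W2 by (simp add: distribs algebra_simps)
    also have "anorm A \<dots> \<le> anorm A (W n \<odot> (W n - w) + (W n - w) \<odot> w) + anorm A ((W (Suc n) - w) + (W (Suc n) - w))"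
      by (rule norm_diff) auto
    also have "\<dots> \<le> (anorm A (W n) * anorm A (W n - w) + anorm A (W n - w) * anorm A w)
        + (anorm A (W (Suc n) - w) + anorm A (W (Suc n) - w))"
      by (intro add_mono order_trans[OF norm_triangle] norm_mult) auto
    also have "\<dots> \<le> (1 * anorm A (W n - w) + anorm A (W n - w) * 1)
        + (anorm A (W (Suc n) - w) + anorm A (W (Suc n) - w))"
      using W_le[of n] r01[of n] \<open>anorm A w \<le> 1\<close> norm_nonneg[of "W n - w"] norm_nonneg[of w]
      by (intro add_mono mult_mono) auto
    finally show "anorm A (w + w - (z + w \<odot> w)) \<le> 2 * anorm A (W n - w) + 2 * anorm A (W (Suc n) - w)"
      by simp
  next
    show "(\<lambda>n. 2 * anorm A (W n - w) + 2 * anorm A (W (Suc n) - w)) \<longlonglongrightarrow> 0"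
      using tendsto_add[OF lim'[of 2] LIMSEQ_Suc[OF lim'[of 2]]] by simp
  qed (use z in auto)
  moreover have "b \<odot> w = w \<odot> b" if b: "b \<in> acarrier A" "b \<odot> z = z \<odot> b" for b
  proof (rule eq_if_norm_diff_null[OF _ _ _ lim'[of "2 * anorm A b"]])
    fix n
    have "b \<odot> w - w \<odot> b = (W n - w) \<odot> b - b \<odot> (W n - w)"
      using b Wcomm[OF b] by (simp add: distribs)
    also have "anorm A \<dots> \<le> anorm A (W n - w) * anorm A b + anorm A b * anorm A (W n - w)"
      using b by (intro order_trans[OF norm_diff] add_mono norm_mult) auto
    finally show "anorm A (b \<odot> w - w \<odot> b) \<le> (2 * anorm A b) * anorm A (W n - w)" by simp
  qed (use b in auto)
  ultimately show thesis using that[of w] by simp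
qed

end

section \<open>The order of a unital algebra, by distance to the unit\<close>

locale unital_cstar_algebra = cstar_algebra A for A :: "'a::ab_group_add cstar_struct" (structure) +
  fixes one :: 'a ("\<one>")
  assumes one_closed [simp, intro]: "\<one> \<in> acarrier A"
    and one_left [simp]: "a \<in> acarrier A \<Longrightarrow> \<one> \<odot> a = a"
    and one_right [simp]: "a \<in> acarrier A \<Longrightarrow> a \<odot> \<one> = a"
begin

lemma star_one [simp]: "astar A \<one> = \<one>"
  using star_mult[of "astar A \<one>" \<one>] star_star[of \<one>] by simp

lemma norm_one: "anorm A \<one> \<le> 1"
  using cstar_identity[of \<one>] by (auto simp: power2_eq_square)

text \<open>The root is required to be self-adjoint, unlike in \<open>positive\<close>; this is the
  form that the norm criterion produces. \<open>nonneg_star_mult\<close> shows later that both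
  notions agree.\<close>

definition nonneg :: "'a \<Rightarrow> bool" where
  "nonneg a \<longleftrightarrow> (\<exists>h\<in>acarrier A. astar A h = h \<and> a = h \<odot> h)"

lemma nonnegI: "\<lbrakk>h \<in> acarrier A; astar A h = h; a = h \<odot> h\<rbrakk> \<Longrightarrow> nonneg a"
  unfolding nonneg_def by blast

lemma nonneg_closed: "nonneg a \<Longrightarrow> a \<in> acarrier A"
  unfolding nonneg_def by auto

lemma nonneg_selfadj: "nonneg a \<Longrightarrow> astar A a = a"
  unfolding nonneg_def by (auto simp: star_simps)

lemma nonneg_scale:
  assumes "nonneg a" "0 \<le> r" shows "nonneg (ascale A (of_real r) a)"
proof -
  obtain h where h: "h \<in> acarrier A" "astar A h = h" "a = h \<odot> h"
    using assms(1) unfolding nonneg_def by blast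
  have "complex_of_real (sqrt r) * complex_of_real (sqrt r) = of_real r"
    using assms(2) by (metis of_real_mult real_sqrt_mult_self abs_of_nonneg)
  then show ?thesis
    by (intro nonnegI[of "ascale A (of_real (sqrt r)) h"]) (use h in \<open>auto simp: distribs star_simps\<close>)
qed

text \<open>If \<open>h\<^sup>2 + s\<^sup>2 = 1\<close>, then \<open>h + \<i>s\<close> is unitary, and \<open>h\<close> and \<open>s\<close> are its real and imaginary parts.\<close>
lemma norm_le_one_if_circle:
  assumes h: "h \<in> acarrier A" "astar A h = h" and s: "s \<in> acarrier A" "astar A s = s"
    and comm: "h \<odot> s = s \<odot> h" and circle: "h \<odot> h + s \<odot> s = \<one>"
  shows "anorm A h \<le> 1"
proof -
  let ?u = "h + ascale A \<i> s"
  have u: "?u \<in> acarrier A" using h s by auto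
  have us: "astar A ?u = h - ascale A \<i> s" using h s by (simp add: star_simps)
  have "astar A ?u \<odot> ?u = h \<odot> h + s \<odot> s"
    unfolding us using h s comm by (simp add: distribs algebra_simps)
  then have "(anorm A ?u)\<^sup>2 \<le> 1" using cstar_identity[OF u] circle norm_one by simp
  then have u1: "anorm A ?u \<le> 1" using norm_nonneg[OF u] by (simp add: power_le_one_iff abs_le_square_iff)
  have "ascale A 2 h = ?u + astar A ?u" unfolding us using scale_left_distrib[of 1 1 h] by simp
  then have "anorm A (ascale A 2 h) \<le> 2"
    using norm_triangle[of ?u "astar A ?u"] norm_star[OF u] u u1 by auto
  then show ?thesis using h by (simp add: norm_scale)
qed

text \<open>Take \<open>s = 1 - w\<close> for the \<open>w\<close> belonging to
  \<open>z = 1 - b\<close>. The bound on \<open>1 - s\<close> is the one on \<open>w\<close>; it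
  allows a second application to \<open>s\<close> itself.\<close>

lemma sqrt_near_one:
  assumes b: "b \<in> acarrier A" "astar A b = b" "anorm A (\<one> - b) \<le> 1"
  obtains s where "s \<in> acarrier A" "astar A s = s" "s \<odot> s = b" "anorm A (\<one> - s) \<le> 1"
    "\<And>d. d \<in> acarrier A \<Longrightarrow> d \<odot> b = b \<odot> d \<Longrightarrow> d \<odot> s = s \<odot> d"
proof -
  have z: "\<one> - b \<in> acarrier A" "astar A (\<one> - b) = \<one> - b" using b by (auto simp: star_simps)
  obtain w where w: "w \<in> acarrier A" "astar A w = w" "anorm A w \<le> 1" "w + w = (\<one> - b) + w \<odot> w"
    and wc: "\<And>d. d \<in> acarrier A \<Longrightarrow> d \<odot> (\<one> - b) = (\<one> - b) \<odot> d \<Longrightarrow> d \<odot> w = w \<odot> d"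
    using sqrt_one_minus[OF z b(3)] by blast
  have "(\<one> - w) \<odot> (\<one> - w) = \<one> - (w + w) + w \<odot> w" using w(1) by (simp add: distribs algebra_simps)
  also have "\<dots> = b" unfolding w(4) by simp
  finally have "(\<one> - w) \<odot> (\<one> - w) = b" .
  moreover have "d \<odot> (\<one> - w) = (\<one> - w) \<odot> d" if "d \<in> acarrier A" "d \<odot> b = b \<odot> d" for d
    using wc[of d] that w b by (simp add: distribs)
  ultimately show thesis
    using w by (intro that[of "\<one> - w"]) (auto simp: star_simps)
qed

text \<open>Since \<open>1 - (1 - h h) = h h\<close> has norm at most 1, there is a root
  \<open>s\<close> of \<open>1 - h h\<close>, and it commutes with \<open>h\<close>. The pair lies
  on the circle, so \<open>s\<close> has norm at most 1, and so has its square.\<close>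

lemma norm_one_minus_square:
  assumes h: "h \<in> acarrier A" "astar A h = h" "anorm A h \<le> 1"
  shows "anorm A (\<one> - h \<odot> h) \<le> 1"
proof -
  let ?b = "\<one> - h \<odot> h"
  have b: "?b \<in> acarrier A" "astar A ?b = ?b" using h by (auto simp: star_simps)
  have b1: "anorm A (\<one> - ?b) \<le> 1"
    using h norm_selfadj_square[of h] norm_nonneg[of h] by (simp add: power_le_one)
  obtain s where s: "s \<in> acarrier A" "astar A s = s" "s \<odot> s = ?b"
    and sc: "\<And>d. d \<in> acarrier A \<Longrightarrow> d \<odot> ?b = ?b \<odot> d \<Longrightarrow> d \<odot> s = s \<odot> d"
    using sqrt_near_one[OF b b1] by blast
  have "h \<odot> s = s \<odot> h" by (rule sc) (use h in \<open>auto simp: distribs\<close>)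
  then have "anorm A s \<le> 1"
    using norm_le_one_if_circle[of s h] h s by simp
  then show ?thesis using norm_selfadj_square[of s] norm_nonneg[of s] s by (simp add: power_le_one)
qed

text \<open>One direction is the bound on \<open>1 - h h\<close>, the other the root near 1. The
  metric form makes the convexity of the cone visible.\<close>

lemma nonneg_iff_near_one:
  assumes "a \<in> acarrier A" "astar A a = a" "anorm A a \<le> 1"
  shows "nonneg a \<longleftrightarrow> anorm A (\<one> - a) \<le> 1"
proof
  assume "nonneg a"
  then obtain h where h: "h \<in> acarrier A" "astar A h = h" "a = h \<odot> h" unfolding nonneg_def by blast
  then have "(anorm A h)\<^sup>2 \<le> 1" using assms(3) norm_selfadj_square by metis
  then have "anorm A h \<le> 1" using norm_nonneg[of h] h by (simp add: power_le_one_iff abs_le_square_iff)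
  then show "anorm A (\<one> - a) \<le> 1" using norm_one_minus_square h by simp
next
  assume "anorm A (\<one> - a) \<le> 1"
  then show "nonneg a" using sqrt_near_one[OF assms(1,2)] nonnegI by metis
qed

lemma nonneg_scale_iff:
  assumes "a \<in> acarrier A" "r > 0"
  shows "nonneg (ascale A (of_real r) a) \<longleftrightarrow> nonneg a"
  using nonneg_scale[of a r] nonneg_scale[of "ascale A (of_real r) a" "1/r"] assms
  by (auto simp flip: of_real_mult simp del: of_real_divide)

text \<open>A common factor \<open>1/t\<close> moves both summands into the unit ball, where they
  lie within distance 1 of the unit. So does their midpoint, which is again in the unit ball. The
  maximum with 1 keeps \<open>t\<close> positive.\<close>

lemma nonneg_add:
  assumes a: "nonneg a" and b: "nonneg b" shows "nonneg (a + b)"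
proof -
  note c [simp] = nonneg_closed[OF a] nonneg_closed[OF b]
  note sa [simp] = nonneg_selfadj[OF a] nonneg_selfadj[OF b]
  define t where "t = max 1 (max (anorm A a) (anorm A b))"
  have t: "t > 0" "anorm A a \<le> t" "anorm A b \<le> t" unfolding t_def by auto
  define r where "r = complex_of_real (1 / t)"
  have r: "cnj r = r" "cmod r = 1 / t" using t by (auto simp: r_def norm_divide)
  have *: "anorm A (\<one> - ascale A r x) \<le> 1 \<and> anorm A (ascale A r x) \<le> 1" if x: "nonneg x" "anorm A x \<le> t" for x
  proof -
    have "anorm A (ascale A r x) \<le> 1" using x t nonneg_closed[of x] by (simp add: norm_scale r)
    moreover have "nonneg (ascale A r x)" unfolding r_def using nonneg_scale[of x "1/t"] x t by simp
    ultimately show ?thesis using nonneg_iff_near_one nonneg_closed nonneg_selfadj by blast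
  qed
  let ?c = "ascale A (1/2) (ascale A r (a + b))"
  have "\<one> = ascale A (1/2) \<one> + ascale A (1/2) \<one>" using scale_left_distrib[of "1/2" "1/2" \<one>] by simp
  then have "\<one> - ?c = ascale A (1/2) (\<one> - ascale A r a) + ascale A (1/2) (\<one> - ascale A r b)"
    by (simp add: scale_right_distrib scale_right_diff_distrib algebra_simps)
  then have "anorm A (\<one> - ?c) \<le> 1"
    using norm_triangle[of "ascale A (1/2) (\<one> - ascale A r a)" "ascale A (1/2) (\<one> - ascale A r b)"]
      *[OF a t(2)] *[OF b t(3)] by (simp add: norm_scale)
  moreover have "anorm A ?c \<le> 1"
    using norm_triangle[of "ascale A r a" "ascale A r b"] *[OF a t(2)] *[OF b t(3)]
    by (simp only: norm_scale closed c scale_right_distrib[of r]) (auto simp: norm_scale)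
  ultimately have "nonneg ?c" by (subst nonneg_iff_near_one) (auto simp: star_simps r)
  moreover have "?c = ascale A (of_real (1 / (2 * t))) (a + b)" by (simp add: r_def mult.commute)
  ultimately show ?thesis using nonneg_scale_iff[of "a + b" "1 / (2 * t)"] t by (simp only:) simp
qed

text \<open>After scaling into the unit ball the root near 1 is available. It is within distance 1
  of the unit itself, so it has a self-adjoint root \<open>q\<close> and is nonnegative.\<close>

lemma nonneg_sqrt:
  assumes b: "nonneg b"
  obtains s where "s \<in> acarrier A" "astar A s = s" "s \<odot> s = b" "nonneg s"
    "\<And>d. d \<in> acarrier A \<Longrightarrow> d \<odot> b = b \<odot> d \<Longrightarrow> d \<odot> s = s \<odot> d"
proof -
  note bc [simp] = nonneg_closed[OF b] nonneg_selfadj[OF b]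
  define t where "t = max 1 (anorm A b)"
  have t: "t > 0" "anorm A b \<le> t" unfolding t_def by auto
  define c where "c = ascale A (of_real (1/t)) b"
  have c: "c \<in> acarrier A" "astar A c = c" "anorm A c \<le> 1" "nonneg c"
    unfolding c_def using t b nonneg_scale[of b "1/t"] by (auto simp: star_simps norm_scale norm_divide)
  then have "anorm A (\<one> - c) \<le> 1" using nonneg_iff_near_one by blast
  then obtain s where s: "s \<in> acarrier A" "astar A s = s" "s \<odot> s = c" "anorm A (\<one> - s) \<le> 1"
    and sc: "\<And>d. d \<in> acarrier A \<Longrightarrow> d \<odot> c = c \<odot> d \<Longrightarrow> d \<odot> s = s \<odot> d"
    using sqrt_near_one[OF c(1,2)] by blast
  obtain q where "q \<in> acarrier A" "astar A q = q" "q \<odot> q = s"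
    using sqrt_near_one[OF s(1,2,4)] by blast
  then have "nonneg s" using nonnegI by blast
  let ?k = "complex_of_real (sqrt t)" and ?s = "ascale A (of_real (sqrt t)) s"
  have k: "?k * ?k = of_real t" using t by (metis of_real_mult real_sqrt_mult_self abs_of_pos)
  have sq: "?s \<odot> ?s = b"
    using s t k by (simp add: distribs c_def flip: of_real_mult)
  have nn: "nonneg ?s" using nonneg_scale[OF \<open>nonneg s\<close>] t by simp
  have comm: "d \<odot> ?s = ?s \<odot> d" if "d \<in> acarrier A" "d \<odot> b = b \<odot> d" for d
    using sc[of d] that s by (simp add: distribs c_def)
  show thesis
    by (rule that[OF nonneg_closed[OF nn] nonneg_selfadj[OF nn] sq nn comm])
qed

text \<open>Write \<open>a = h h\<close> and \<open>1 - a = k k\<close>. Since \<open>h\<close>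
  commutes with \<open>1 - a\<close>, the root \<open>k\<close> can be chosen to commute with
  \<open>h\<close>, which puts the pair on the circle.\<close>

lemma norm_le_one_if_nonneg:
  assumes a: "nonneg a" and b: "nonneg (\<one> - a)" shows "anorm A a \<le> 1"
proof -
  obtain h where h: "h \<in> acarrier A" "astar A h = h" "a = h \<odot> h" using a unfolding nonneg_def by blast
  obtain k where k: "k \<in> acarrier A" "astar A k = k" "k \<odot> k = \<one> - a"
    and kc: "\<And>d. d \<in> acarrier A \<Longrightarrow> d \<odot> (\<one> - a) = (\<one> - a) \<odot> d \<Longrightarrow> d \<odot> k = k \<odot> d"
    using nonneg_sqrt[OF b] by blast
  have "h \<odot> k = k \<odot> h" by (rule kc) (use h in \<open>auto simp: distribs\<close>)
  then have "anorm A h \<le> 1" using norm_le_one_if_circle[of h k] h k by simp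
  then show ?thesis using norm_selfadj_square[of h] norm_nonneg[of h] h by (simp add: power_le_one)
qed

text \<open>The element \<open>1 - b/t\<close> is within distance 1 of the unit, hence a
  square.\<close>

lemma nonneg_scale_one_minus:
  assumes b: "b \<in> acarrier A" "astar A b = b" and t: "anorm A b \<le> t" "t > 0"
  shows "nonneg (ascale A (of_real t) \<one> - b)"
proof -
  let ?c = "\<one> - ascale A (of_real (1/t)) b"
  have "anorm A (\<one> - ?c) \<le> 1" "?c \<in> acarrier A" "astar A ?c = ?c"
    using b t by (auto simp: norm_scale norm_divide star_simps)
  then have "nonneg ?c"
    using sqrt_near_one[of ?c] nonnegI by metis
  from nonneg_scale[OF this, of t] show ?thesis
    using t b by (simp add: scale_right_diff_distrib)
qed

text \<open>For \<open>t > \<parallel>b\<parallel>\<close> the chain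
  \<open>a \<le> b \<le> t 1\<close> shows that \<open>a/t\<close> and \<open>1 - a/t\<close> are
  nonnegative. The slack \<open>e\<close> keeps \<open>t\<close> positive when
  \<open>b = 0\<close>.\<close>

lemma norm_mono:
  assumes a: "nonneg a" and b: "nonneg (b - a)" shows "anorm A a \<le> anorm A b"
proof (rule field_le_epsilon)
  fix e :: real assume e: "e > 0"
  note ac [simp] = nonneg_closed[OF a] nonneg_selfadj[OF a]
  let ?t = "anorm A b + e"
  have "nonneg b" using nonneg_add[OF a b] by simp
  note bc [simp] = nonneg_closed[OF this] nonneg_selfadj[OF this]
  have t: "?t > 0" using e norm_nonneg[of b] by simp
  have "nonneg (ascale A (of_real ?t) \<one> - b)"
    using nonneg_scale_one_minus[of b ?t] e t by simp
  from nonneg_add[OF this b] have "nonneg (ascale A (of_real ?t) \<one> - a)" by simp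
  from nonneg_scale[OF this, of "1 / ?t"] have "nonneg (\<one> - ascale A (of_real (1 / ?t)) a)"
    using t by (simp add: scale_right_diff_distrib flip: of_real_mult of_real_add)
  then have "anorm A (ascale A (of_real (1 / ?t)) a) \<le> 1"
    using norm_le_one_if_nonneg nonneg_scale[OF a, of "1 / ?t"] t by simp
  then show "anorm A a \<le> ?t" using t by (simp add: norm_scale norm_divide flip: of_real_add)
qed

lemma nonneg_antisym:
  assumes "nonneg a" "nonneg (- a)" shows "a = 0"
  using norm_mono[of a 0] assms nonneg_closed[OF assms(1)] norm_nonneg[of a] norm_eq_zero_iff[of a] by simp

text \<open>
  Here \<open>d = \<bar>a\<bar> - a\<close> and \<open>m = \<bar>a\<bar>\<^sup>1\<^sup>/\<^sup>2\<close>. The element \<open>d\<close> is twice the negative part of \<open>a\<close>, and \<open>m d = 0\<close> holds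
  only if it vanishes.
\<close>
lemma negative_part:
  assumes a: "a \<in> acarrier A" "astar A a = a"
  obtains m d where "m \<in> acarrier A" "astar A m = m" "d \<in> acarrier A" "astar A d = d" "m \<odot> d = d \<odot> m"
    "d \<odot> (a \<odot> d) = - ((m \<odot> d) \<odot> (m \<odot> d))" "m \<odot> d = 0 \<Longrightarrow> a = m \<odot> m"
proof -
  have aa: "nonneg (a \<odot> a)" using a nonnegI by blast
  obtain N where N: "N \<in> acarrier A" "astar A N = N" "N \<odot> N = a \<odot> a" "nonneg N"
    and Nc: "\<And>d. d \<in> acarrier A \<Longrightarrow> d \<odot> (a \<odot> a) = (a \<odot> a) \<odot> d \<Longrightarrow> d \<odot> N = N \<odot> d"
    by (rule nonneg_sqrt[OF aa]) (rule that)
  obtain m where m: "m \<in> acarrier A" "astar A m = m" "m \<odot> m = N"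
    and mc: "\<And>d. d \<in> acarrier A \<Longrightarrow> d \<odot> N = N \<odot> d \<Longrightarrow> d \<odot> m = m \<odot> d"
    by (rule nonneg_sqrt[OF N(4)]) (rule that)
  have aN: "a \<odot> N = N \<odot> a" by (rule Nc) (use a in \<open>auto simp: distribs\<close>)
  define d where "d = N - a"
  have d: "d \<in> acarrier A" "astar A d = d" unfolding d_def using a N by (auto simp: star_simps)
  have dm: "d \<odot> m = m \<odot> d" by (rule mc) (use a N aN d in \<open>auto simp: distribs d_def\<close>)
  \<comment> \<open>Because \<open>a a = N N\<close> and both commute, \<open>a\<close> acts on
    \<open>d = N - a\<close> as \<open>- N\<close> does.\<close>
  have ad: "a \<odot> d = - (N \<odot> d)" unfolding d_def using a N aN by (simp add: distribs)
  have dad: "d \<odot> (a \<odot> d) = - ((m \<odot> d) \<odot> (m \<odot> d))"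
  proof -
    have "d \<odot> (N \<odot> d) = (d \<odot> m) \<odot> (m \<odot> d)" using m d by (simp add: mult_assoc flip: m(3))
    then show ?thesis using ad dm d N by (simp add: mult_minus_right)
  qed
  have "a = m \<odot> m" if "m \<odot> d = 0"
  proof -
    have Nd: "N \<odot> d = 0" using m d that by (simp add: mult_assoc flip: m(3))
    then have "d \<odot> d = 0" using ad N a d unfolding d_def by (simp add: distribs)
    then have "d = 0" using selfadj_square_eq_0 d by blast
    then show ?thesis using m unfolding d_def by simp
  qed
  then show thesis using m d dm dad by (intro that[of m d]) auto
qed

text \<open>
  With \<open>p = - c\<^sup>*c\<close> and \<open>q = c c\<^sup>*\<close> both nonnegative and of norm 1, the identity \<open>(1 + q)\<^sup>2 q = c (1 - p)\<^sup>2 c\<^sup>*\<close>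
  bounds the norm of \<open>2 q\<^sup>2 \<le> (1 + q)\<^sup>2 q\<close> by 1.
\<close>
lemma neg_star_mult_nonneg:
  assumes c: "c \<in> acarrier A" and neg: "nonneg (- (astar A c \<odot> c))"
  shows "c = 0"
proof (rule ccontr)
  assume "c \<noteq> 0"
  then have pos: "anorm A c > 0" using norm_nonneg[OF c] norm_eq_zero_iff[OF c] by linarith
  define e where "e = ascale A (of_real (1 / anorm A c)) c"
  have e [simp]: "e \<in> acarrier A" and e1: "anorm A e = 1"
    unfolding e_def using c pos by (auto simp: norm_scale norm_divide)
  define p where "p = - (astar A e \<odot> e)"
  have p_eq: "p = ascale A (of_real ((1 / anorm A c)\<^sup>2)) (- (astar A c \<odot> c))"
    unfolding p_def e_def using c by (simp add: distribs star_simps power2_eq_square)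
  have p: "nonneg p" unfolding p_eq by (rule nonneg_scale[OF neg]) simp
  note pc [simp] = nonneg_closed[OF p] nonneg_selfadj[OF p]
  have p1: "anorm A (\<one> - p) \<le> 1"
  proof -
    have "anorm A p \<le> 1" using cstar_identity[of e] e1 by (simp add: p_def norm_minus)
    then show ?thesis using nonneg_iff_near_one p pc by blast
  qed
  define q where "q = e \<odot> astar A e"
  have qc [simp]: "q \<in> acarrier A" "astar A q = q" unfolding q_def by (auto simp: star_simps)
  have q1: "anorm A q = 1"
    using cstar_identity[of "astar A e"] e1 by (simp add: q_def star_star norm_star)
  have q: "nonneg q"
  proof -
    \<comment> \<open>Up to sign, \<open>x\<close> and \<open>y\<close> are twice the real and
      imaginary parts of \<open>e\<close>. Their squares add up to
      \<open>2 e\<^sup>* e + 2 e e\<^sup>*\<close>, so adding \<open>2 p\<close> leaves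
      \<open>2 q\<close>.\<close>
    let ?x = "e + astar A e" and ?y = "ascale A \<i> (e - astar A e)"
    have "nonneg (?x \<odot> ?x)"
      by (rule nonnegI[of ?x]) (auto simp: star_simps algebra_simps)
    moreover have "nonneg (?y \<odot> ?y)"
      by (rule nonnegI[of ?y]) (auto simp: star_simps algebra_simps)
    ultimately have "nonneg (?x \<odot> ?x + ?y \<odot> ?y + (p + p))" using p by (intro nonneg_add)
    also have "?x \<odot> ?x + ?y \<odot> ?y + (p + p) = ascale A (of_real 2) q"
      unfolding p_def q_def using scale_left_distrib[of 1 1 "e \<odot> astar A e"]
      by (simp add: distribs algebra_simps)
    finally show ?thesis using nonneg_scale_iff[of q 2] by simp
  qed
  then obtain h where h: "h \<in> acarrier A" "astar A h = h" "q = h \<odot> h" unfolding nonneg_def by blast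
  have q3: "nonneg (q \<odot> (q \<odot> q))"
    by (rule nonnegI[of "h \<odot> (h \<odot> h)"]) (use h in \<open>auto simp: star_simps distribs\<close>)
  let ?F = "q + (q \<odot> q + q \<odot> q) + q \<odot> (q \<odot> q)"
  \<comment> \<open>Bracketing \<open>e e\<^sup>* e\<close> in two ways: \<open>e\<close>
    intertwines \<open>1 - p\<close> with \<open>1 + q\<close>.\<close>
  have qe: "q \<odot> e = - (e \<odot> p)" unfolding p_def q_def by (simp add: distribs)
  have "e \<odot> (\<one> - p) = (\<one> + q) \<odot> e" using qe by (simp add: distribs)
  then have "(e \<odot> ((\<one> - p) \<odot> (\<one> - p))) \<odot> astar A e = ((\<one> + q) \<odot> ((\<one> + q) \<odot> e)) \<odot> astar A e"
    by (metis add.commute closed e mult_assoc one_closed pc(1) qc(1))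
  also have "\<dots> = (\<one> + q) \<odot> ((\<one> + q) \<odot> q)" by (simp add: q_def mult_assoc)
  also have "\<dots> = ?F" by (simp add: distribs algebra_simps)
  finally have "?F = (e \<odot> ((\<one> - p) \<odot> (\<one> - p))) \<odot> astar A e" ..
  then have "anorm A ?F \<le> anorm A e * (anorm A (\<one> - p) * anorm A (\<one> - p)) * anorm A (astar A e)"
    by (auto intro!: order_trans[OF norm_mult] mult_mono norm_nonneg mult_nonneg_nonneg)
  also have "\<dots> \<le> 1"
    using p1 norm_nonneg[of "\<one> - p"] e1 by (simp add: norm_star mult_le_one)
  finally have "anorm A ?F \<le> 1" .
  moreover have "anorm A (q \<odot> q + q \<odot> q) \<le> anorm A ?F"
  proof (rule norm_mono)
    have "nonneg (q \<odot> q)" by (rule nonnegI[of q]) auto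
    then show "nonneg (q \<odot> q + q \<odot> q)" by (intro nonneg_add)
    have "nonneg (q + q \<odot> (q \<odot> q))" by (intro nonneg_add q q3)
    then show "nonneg (?F - (q \<odot> q + q \<odot> q))" by (simp add: algebra_simps)
  qed
  moreover have "anorm A (q \<odot> q + q \<odot> q) = 2"
    using norm_scale[of "q \<odot> q" 2] scale_left_distrib[of 1 1 "q \<odot> q"] norm_selfadj_square[of q] q1 by simp
  ultimately show False by simp
qed

text \<open>Let \<open>d\<close> be twice the negative part of \<open>a = b\<^sup>* b\<close>, and
  \<open>c = b d\<close>. Then \<open>- c\<^sup>* c = - d a d\<close> is the square of the
  self-adjoint \<open>m d\<close>, hence \<open>c = 0\<close>, so \<open>m d = 0\<close> and
  \<open>a = m m\<close>.\<close>

theorem nonneg_star_mult: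
  assumes b: "b \<in> acarrier A" shows "nonneg (astar A b \<odot> b)"
proof -
  let ?a = "astar A b \<odot> b"
  have a: "?a \<in> acarrier A" "astar A ?a = ?a" using b by (auto simp: star_simps)
  obtain m d where m: "m \<in> acarrier A" "astar A m = m" and d: "d \<in> acarrier A" "astar A d = d"
    and md: "m \<odot> d = d \<odot> m" and dad: "d \<odot> (?a \<odot> d) = - ((m \<odot> d) \<odot> (m \<odot> d))"
    and eq: "m \<odot> d = 0 \<Longrightarrow> ?a = m \<odot> m"
    using negative_part[OF a] by blast
  have mds: "m \<odot> d \<in> acarrier A" "astar A (m \<odot> d) = m \<odot> d" using m d md by (auto simp: star_simps)
  have "astar A (b \<odot> d) \<odot> (b \<odot> d) = d \<odot> (?a \<odot> d)" using b d by (simp add: star_simps mult_assoc)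
  then have c: "- (astar A (b \<odot> d) \<odot> (b \<odot> d)) = (m \<odot> d) \<odot> (m \<odot> d)" using dad by simp
  have "b \<odot> d = 0"
  proof (rule neg_star_mult_nonneg)
    show "nonneg (- (astar A (b \<odot> d) \<odot> (b \<odot> d)))" unfolding c by (rule nonnegI[OF mds]) simp
  qed (use b d in auto)
  then have "m \<odot> d = 0" using c selfadj_square_eq_0[OF mds] by simp
  then show ?thesis using eq m nonnegI by metis
qed

end

section \<open>Adjoints on Hilbert modules\<close>

text \<open>
  The Cauchy-Schwarz inequality holds in every Hilbert module, but its proof uses the order on the
  multiplier algebra \<open>\<L>(A)\<close> of \<open>A\<close>. It is therefore a hypothesis at first, trivially satisfied by \<open>A\<close>
  itself; this yields the \<open>C\<^sup>*\<close>-algebra \<open>\<L>(A)\<close>, and then the inequality in general.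
\<close>
locale cauchy_schwarz_module = hilbert_module A E
  for A :: "'a::ab_group_add cstar_struct" (structure) and E :: "('a, 'e::ab_group_add) hmod_struct" +
  assumes cauchy_schwarz: "\<lbrakk>x \<in> ecarrier E; y \<in> ecarrier E\<rbrakk> \<Longrightarrow> anorm A (einner E x y) \<le> enorm A E x * enorm A E y"

section \<open>Elementary calculus of inner products and norms in a module\<close>

context hilbert_module
begin

lemmas E_closed [simp, intro] =
  E.subspace_0[OF ecarrier_subspace] E.subspace_add[OF ecarrier_subspace] E.subspace_diff[OF ecarrier_subspace]
  E.subspace_scale[OF ecarrier_subspace] E.subspace_neg[OF ecarrier_subspace] act_closed inner_closed

lemma inner_add_left:
  "\<lbrakk>x \<in> ecarrier E; y \<in> ecarrier E; z \<in> ecarrier E\<rbrakk> \<Longrightarrow> einner E (x + y) z = einner E x z + einner E y z"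
  using inner_commute[of z "x + y"] inner_commute[of z x] inner_commute[of z y]
  by (simp add: inner_add_right star_add)

lemma inner_scale_left:
  "\<lbrakk>x \<in> ecarrier E; y \<in> ecarrier E\<rbrakk> \<Longrightarrow> einner E (escale E c x) y = ascale A (cnj c) (einner E x y)"
  using inner_commute[of y "escale E c x"] inner_commute[of y x]
  by (simp add: inner_scale_right star_scale)

lemma inner_act_left:
  "\<lbrakk>x \<in> ecarrier E; y \<in> ecarrier E; a \<in> acarrier A\<rbrakk> \<Longrightarrow> einner E (eact E x a) y = astar A a \<odot> einner E x y"
  using inner_commute[of y "eact E x a"] inner_commute[of y x]
  by (simp add: inner_act_right star_mult)

lemma inner_zero_right [simp]: "x \<in> ecarrier E \<Longrightarrow> einner E x 0 = 0"
  using inner_scale_right[of x x 0] by simp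

lemma inner_zero_left [simp]: "x \<in> ecarrier E \<Longrightarrow> einner E 0 x = 0"
  using inner_scale_left[of x x 0] by simp

lemma inner_diff_right:
  "\<lbrakk>x \<in> ecarrier E; y \<in> ecarrier E; z \<in> ecarrier E\<rbrakk> \<Longrightarrow> einner E x (y - z) = einner E x y - einner E x z"
  using inner_add_right[of x "y - z" z] by simp

lemma inner_diff_left:
  "\<lbrakk>x \<in> ecarrier E; y \<in> ecarrier E; z \<in> ecarrier E\<rbrakk> \<Longrightarrow> einner E (x - y) z = einner E x z - einner E y z"
  using inner_add_left[of "x - y" y z] by simp

lemma eq_if_inner_eq:
  assumes "x \<in> ecarrier E" "y \<in> ecarrier E" "\<And>z. z \<in> ecarrier E \<Longrightarrow> einner E z x = einner E z y"
  shows "x = y"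
  using inner_eq_zero[of "x - y"] assms by (simp add: inner_diff_right)

lemma enorm_nonneg: "x \<in> ecarrier E \<Longrightarrow> 0 \<le> enorm A E x"
  unfolding enorm_def using norm_nonneg by simp

lemma enorm_squared: "x \<in> ecarrier E \<Longrightarrow> (enorm A E x)\<^sup>2 = anorm A (einner E x x)"
  unfolding enorm_def using norm_nonneg by simp

lemma enorm_zero [simp]: "enorm A E 0 = 0"
  by (simp add: enorm_def)

lemma enorm_eq_0_iff: "x \<in> ecarrier E \<Longrightarrow> enorm A E x = 0 \<longleftrightarrow> x = 0"
  using enorm_squared[of x] inner_eq_zero[of x] norm_eq_zero_iff[of "einner E x x"] by (auto simp: enorm_def)

lemma enorm_scale:
  assumes x: "x \<in> ecarrier E" shows "enorm A E (escale E c x) = cmod c * enorm A E x"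
proof -
  have "anorm A (einner E (escale E c x) (escale E c x)) = (cmod c)\<^sup>2 * anorm A (einner E x x)"
    using x by (simp only: inner_scale_left inner_scale_right norm_scale E_closed closed complex_mod_cnj)
      (simp add: power2_eq_square)
  then show ?thesis by (simp add: enorm_def real_sqrt_mult)
qed

lemma enorm_minus: "x \<in> ecarrier E \<Longrightarrow> enorm A E (- x) = enorm A E x"
  using enorm_scale[of x "-1"] by simp

lemma enorm_diff_commute: "\<lbrakk>x \<in> ecarrier E; y \<in> ecarrier E\<rbrakk> \<Longrightarrow> enorm A E (x - y) = enorm A E (y - x)"
  using enorm_minus[of "x - y"] by simp

end

context cauchy_schwarz_module
begin

lemma enorm_triangle:
  assumes x: "x \<in> ecarrier E" and y: "y \<in> ecarrier E"
  shows "enorm A E (x + y) \<le> enorm A E x + enorm A E y"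
proof (rule power2_le_imp_le)
  have "einner E (x + y) (x + y) = (einner E x x + einner E x y) + (einner E y x + einner E y y)"
    using x y by (simp add: inner_add_left inner_add_right add_ac)
  also have "anorm A \<dots> \<le> (anorm A (einner E x x) + anorm A (einner E x y)) + (anorm A (einner E y x) + anorm A (einner E y y))"
    using x y by (intro order_trans[OF norm_triangle] add_mono norm_triangle) auto
  also have "\<dots> \<le> (enorm A E x * enorm A E x + enorm A E x * enorm A E y) + (enorm A E y * enorm A E x + enorm A E y * enorm A E y)"
    using x y by (intro add_mono cauchy_schwarz)
  also have "\<dots> = (enorm A E x + enorm A E y)\<^sup>2" by (simp add: power2_eq_square algebra_simps)
  finally show "(enorm A E (x + y))\<^sup>2 \<le> (enorm A E x + enorm A E y)\<^sup>2"
    using x y by (simp add: enorm_squared)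
qed (use x y enorm_nonneg in auto)

lemma enorm_diff_triangle:
  "\<lbrakk>x \<in> ecarrier E; y \<in> ecarrier E; z \<in> ecarrier E\<rbrakk> \<Longrightarrow> enorm A E (x - z) \<le> enorm A E (x - y) + enorm A E (y - z)"
  using enorm_triangle[of "x - y" "y - z"] by simp

end

text \<open>
  The pair \<open>(id, id)\<close> gives the adjointable operators, \<open>(\<sharp>, cnj)\<close> the \<open>\<sharp>\<close>-adjointable ones.
\<close>
locale twisted_module = cauchy_schwarz_module A E
  for A :: "'a::ab_group_add cstar_struct" (structure) and E :: "('a, 'e::ab_group_add) hmod_struct" +
  fixes s :: "'a \<Rightarrow> 'a" and \<sigma> :: "complex \<Rightarrow> complex"
  assumes s_closed [simp, intro]: "a \<in> acarrier A \<Longrightarrow> s a \<in> acarrier A"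
    and s_add: "\<lbrakk>a \<in> acarrier A; b \<in> acarrier A\<rbrakk> \<Longrightarrow> s (a + b) = s a + s b"
    and s_scale: "a \<in> acarrier A \<Longrightarrow> s (ascale A c a) = ascale A (\<sigma> c) (s a)"
    and s_s: "a \<in> acarrier A \<Longrightarrow> s (s a) = a"
    and s_star: "a \<in> acarrier A \<Longrightarrow> astar A (s a) = s (astar A a)"
    and s_norm: "a \<in> acarrier A \<Longrightarrow> anorm A (s a) = anorm A a"
    and \<sigma>_cnj: "\<sigma> (cnj c) = cnj (\<sigma> c)"
    and \<sigma>_one: "\<sigma> 1 = 1"
    and \<sigma>_\<sigma>: "\<sigma> (\<sigma> c) = c"
    and \<sigma>_norm: "cmod (\<sigma> c) = cmod c"

text \<open>Semilinearity and boundedness are consequences of this relation, so that it describes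
  linear operators for \<open>s = id\<close> and conjugate-linear ones for
  \<open>s = \<sharp>\<close> without separate definitions.\<close>

definition adjoint_pair ::
  "('a, 'e::ab_group_add) hmod_struct \<Rightarrow> ('a \<Rightarrow> 'a) \<Rightarrow> ('e \<Rightarrow> 'e) \<Rightarrow> ('e \<Rightarrow> 'e) \<Rightarrow> bool"
where
  "adjoint_pair E s T R \<longleftrightarrow> T \<in> carrier_maps E \<and> R \<in> carrier_maps E \<and>
     (\<forall>x\<in>ecarrier E. \<forall>y\<in>ecarrier E. einner E (T x) y = s (einner E x (R y)))"

lemma carrier_maps_closed: "\<lbrakk>T \<in> carrier_maps E; x \<in> ecarrier E\<rbrakk> \<Longrightarrow> T x \<in> ecarrier E"
  by (simp add: carrier_maps_def)

lemma carrier_maps_outside: "\<lbrakk>T \<in> carrier_maps E; x \<notin> ecarrier E\<rbrakk> \<Longrightarrow> T x = 0"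
  by (simp add: carrier_maps_def)

lemma carrier_maps_eqI:
  assumes "T \<in> carrier_maps E" "R \<in> carrier_maps E" "\<And>x. x \<in> ecarrier E \<Longrightarrow> T x = R x"
  shows "T = R"
  using assms by (metis carrier_maps_outside ext)

lemma adjoint_pair_maps:
  assumes "adjoint_pair E s T R"
  shows "T \<in> carrier_maps E" "R \<in> carrier_maps E"
  using assms by (auto simp: adjoint_pair_def)

lemma adjoint_pair_closed:
  assumes "adjoint_pair E s T R" "x \<in> ecarrier E"
  shows "T x \<in> ecarrier E" "R x \<in> ecarrier E"
  using assms by (auto simp: adjoint_pair_def carrier_maps_def)

lemma adjoint_pairD:
  "\<lbrakk>adjoint_pair E s T R; x \<in> ecarrier E; y \<in> ecarrier E\<rbrakk> \<Longrightarrow> einner E (T x) y = s (einner E x (R y))"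
  by (simp add: adjoint_pair_def)

section \<open>Algebra of adjoint pairs and automatic boundedness\<close>

context twisted_module
begin

lemma s_zero [simp]: "s 0 = 0"
  using s_add[of 0 0] by simp

lemma s_diff: "\<lbrakk>a \<in> acarrier A; b \<in> acarrier A\<rbrakk> \<Longrightarrow> s (a - b) = s a - s b"
  using s_add[of "a - b" b] by (simp add: algebra_simps)

text \<open>Apply the involution \<open>s\<close> to the defining identity, then the star, which
  exchanges the two slots and commutes with \<open>s\<close>.\<close>

lemma adjoint_pair_sym:
  assumes p: "adjoint_pair E s T R" shows "adjoint_pair E s R T"
  unfolding adjoint_pair_def
proof (intro conjI ballI adjoint_pair_maps[OF p])
  fix x y assume x: "x \<in> ecarrier E" and y: "y \<in> ecarrier E"
  note c = adjoint_pair_closed[OF p]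
  have "s (einner E (T y) x) = einner E y (R x)"
    using adjoint_pairD[OF p y x] s_s x y c by simp
  then have "astar A (s (einner E (T y) x)) = einner E (R x) y"
    using inner_commute[of y "R x"] x y c by simp
  then show "einner E (R x) y = s (einner E x (T y))"
    using inner_commute[of "T y" x] s_star x y c by simp
qed

lemma adjoint_pair_unique:
  assumes p: "adjoint_pair E s T R" and q: "adjoint_pair E s T R'" shows "R = R'"
proof (rule carrier_maps_eqI[of _ E])
  fix x assume x: "x \<in> ecarrier E"
  note c = adjoint_pair_closed[OF p] adjoint_pair_closed[OF q]
  show "R x = R' x"
  proof (rule eq_if_inner_eq)
    fix z assume z: "z \<in> ecarrier E"
    have "s (einner E z (R x)) = s (einner E z (R' x))"
      using adjoint_pairD[OF p z x] adjoint_pairD[OF q z x] by simp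
    then show "einner E z (R x) = einner E z (R' x)" using x z c by (metis inner_closed s_s)
  qed (use x c in auto)
qed (use adjoint_pair_maps(2)[OF p] adjoint_pair_maps(2)[OF q] in auto)

text \<open>By symmetry \<open>\<langle>z, T u\<rangle> = s \<langle>R z, u\<rangle>\<close>, and
  the right-hand side depends on \<open>u\<close> exactly as \<open>s\<close> depends on its
  argument; this is where \<sigma> enters.\<close>

lemma adjoint_pair_semilinear:
  assumes p: "adjoint_pair E s T R" and x: "x \<in> ecarrier E" and y: "y \<in> ecarrier E"
  shows "T (escale E c x + y) = escale E (\<sigma> c) (T x) + T y"
proof (rule eq_if_inner_eq)
  note q = adjoint_pair_sym[OF p]
  note c = adjoint_pair_closed[OF p]
  fix z assume z: "z \<in> ecarrier E"
  have flip: "einner E z (T u) = s (einner E (R z) u)" if u: "u \<in> ecarrier E" for u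
    using adjoint_pairD[OF q z u] s_s z u c by simp
  show "einner E z (T (escale E c x + y)) = einner E z (escale E (\<sigma> c) (T x) + T y)"
    using x y z c by (simp add: flip inner_add_right inner_scale_right s_add s_scale)
qed (use x y adjoint_pair_closed[OF p] in auto)

lemma adjoint_pair_zero: "adjoint_pair E s 0 0"
  by (simp add: adjoint_pair_def carrier_maps_def)

lemma adjoint_pair_add:
  assumes p: "adjoint_pair E s T R" and q: "adjoint_pair E s T' R'"
  shows "adjoint_pair E s (T + T') (R + R')"
  unfolding adjoint_pair_def
proof (intro conjI ballI)
  fix x y assume x: "x \<in> ecarrier E" and y: "y \<in> ecarrier E"
  show "einner E ((T + T') x) y = s (einner E x ((R + R') y))"
    using x y adjoint_pair_closed[OF p] adjoint_pair_closed[OF q] adjoint_pairD[OF p x y] adjoint_pairD[OF q x y]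
    by (simp add: inner_add_left inner_add_right s_add)
qed (use adjoint_pair_maps[OF p] adjoint_pair_maps[OF q] in \<open>auto simp: carrier_maps_def\<close>)

text \<open>The scalar leaves the left slot as \<open>cnj c\<close> and then passes
  \<open>s\<close>: the adjoint receives \<open>cnj c\<close> in the linear case and
  \<open>c\<close> in the conjugate-linear one.\<close>

lemma adjoint_pair_scale:
  assumes p: "adjoint_pair E s T R"
  shows "adjoint_pair E s (\<lambda>x. escale E c (T x)) (\<lambda>x. escale E (\<sigma> (cnj c)) (R x))"
  unfolding adjoint_pair_def
proof (intro conjI ballI)
  fix x y assume x: "x \<in> ecarrier E" and y: "y \<in> ecarrier E"
  show "einner E (escale E c (T x)) y = s (einner E x (escale E (\<sigma> (cnj c)) (R y)))"
    using x y adjoint_pair_closed[OF p] adjoint_pairD[OF p x y]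
    by (simp add: inner_scale_left inner_scale_right s_scale \<sigma>_\<sigma>)
qed (use adjoint_pair_maps[OF p] in \<open>auto simp: carrier_maps_def\<close>)

lemma adjoint_pair_diff:
  assumes p: "adjoint_pair E s T R" and q: "adjoint_pair E s T' R'"
  shows "adjoint_pair E s (T - T') (R - R')"
  unfolding adjoint_pair_def
proof (intro conjI ballI)
  fix x y assume x: "x \<in> ecarrier E" and y: "y \<in> ecarrier E"
  show "einner E ((T - T') x) y = s (einner E x ((R - R') y))"
    using x y adjoint_pair_closed[OF p] adjoint_pair_closed[OF q] adjoint_pairD[OF p x y] adjoint_pairD[OF q x y]
    by (simp add: inner_diff_left inner_diff_right s_diff)
qed (use adjoint_pair_maps[OF p] adjoint_pair_maps[OF q] in \<open>auto simp: carrier_maps_def\<close>)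

lemma adjoint_pair_map_add:
  "\<lbrakk>adjoint_pair E s T R; x \<in> ecarrier E; y \<in> ecarrier E\<rbrakk> \<Longrightarrow> T (x + y) = T x + T y"
  using adjoint_pair_semilinear[of T R x y 1] by (simp add: \<sigma>_one)

lemma adjoint_pair_map_zero: "adjoint_pair E s T R \<Longrightarrow> T 0 = 0"
  using adjoint_pair_map_add[of T R 0 0] by simp

lemma adjoint_pair_map_scale:
  "\<lbrakk>adjoint_pair E s T R; x \<in> ecarrier E\<rbrakk> \<Longrightarrow> T (escale E c x) = escale E (\<sigma> c) (T x)"
  using adjoint_pair_semilinear[of T R x 0 c] by (simp add: adjoint_pair_map_zero)

lemma norm_inner_adjoint:
  assumes "adjoint_pair E s T R" "x \<in> ecarrier E" "y \<in> ecarrier E"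
  shows "anorm A (einner E (T x) y) \<le> enorm A E x * enorm A E (R y)"
  using adjoint_pairD[OF assms] cauchy_schwarz[of x "R y"] adjoint_pair_closed[OF assms(1)] assms
  by (simp add: s_norm)

text \<open>
  Uniform boundedness, by a gliding hump: if \<open>\<parallel>T y\<^sub>n\<parallel> \<ge> 4\<^sup>n\<close> with \<open>\<parallel>y\<^sub>n\<parallel> \<le> 1\<close>, steps of length \<open>3\<^sup>-\<^sup>n\<close> lead to a limit \<open>x\<close>
  such that \<open>\<parallel>\<langle>T y\<^sub>n, x\<rangle>\<parallel> \<ge> (4/3)\<^sup>n / 2\<close>, although this is at most \<open>\<parallel>R x\<parallel>\<close>.
\<close>
lemma adjoint_pair_bounded:
  assumes p: "adjoint_pair E s T R"
  shows "\<exists>C\<ge>0. \<forall>x\<in>ecarrier E. enorm A E (T x) \<le> C * enorm A E x"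
proof (rule ccontr)
  assume "\<not> ?thesis"
  then have unb: "\<exists>y\<in>ecarrier E. enorm A E (T y) > C * enorm A E y" if "C \<ge> 0" for C
    using that by (meson linorder_not_le)
  note c = adjoint_pair_closed[OF p]
  have "\<exists>y. y \<in> ecarrier E \<and> enorm A E y \<le> 1 \<and> enorm A E (T y) \<ge> 4 ^ n" for n
  proof -
    obtain y where y: "y \<in> ecarrier E" "enorm A E (T y) > 4 ^ n * enorm A E y"
      using unb[of "4 ^ n"] by auto
    have "y \<noteq> 0" using y adjoint_pair_map_zero[OF p] by auto
    then have pos: "enorm A E y > 0" using y enorm_nonneg[of y] enorm_eq_0_iff[of y] by linarith
    let ?k = "complex_of_real (1 / enorm A E y)"
    have k: "cmod ?k = 1 / enorm A E y" using pos by (simp add: norm_divide)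
    have "enorm A E (escale E ?k y) = 1" using y pos by (simp only: enorm_scale k) simp
    moreover have "enorm A E (T (escale E ?k y)) = enorm A E (T y) / enorm A E y"
      by (simp only: adjoint_pair_map_scale[OF p y(1)] enorm_scale[OF c(1)[OF y(1)]] \<sigma>_norm k) simp
    moreover have "4 ^ n \<le> enorm A E (T y) / enorm A E y" using y pos by (simp add: field_simps)
    ultimately show ?thesis using y by (metis E_closed(4) order_refl)
  qed
  then obtain Y where Y: "Y n \<in> ecarrier E" "enorm A E (Y n) \<le> 1" "enorm A E (T (Y n)) \<ge> 4 ^ n" for n
    by metis
  define v where "v n = T (Y n)" for n
  have vc [simp]: "v n \<in> ecarrier E" for n unfolding v_def using Y c by blast
  have v4: "enorm A E (v n) \<ge> 4 ^ n" for n unfolding v_def by (rule Y)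
  then have vpos: "enorm A E (v n) > 0" for n by (meson less_le_trans zero_less_numeral zero_less_power)
  have "\<exists>x'. x' \<in> ecarrier E \<and> enorm A E (x' - x) \<le> (1/3) ^ n \<and>
      (1/3) ^ n * enorm A E (v n) \<le> anorm A (einner E (v n) x')" if x: "x \<in> ecarrier E" for n x
  proof -
    let ?k = "complex_of_real ((1/3) ^ n / enorm A E (v n))"
    let ?e = "escale E ?k (v n)"
    have k: "cmod ?k = (1/3) ^ n / enorm A E (v n)" using vpos[of n] by (simp add: norm_divide norm_power)
    have e: "enorm A E ?e = (1/3) ^ n" using vpos[of n] by (simp only: enorm_scale[OF vc] k) simp
    have "anorm A (einner E (v n) ?e) = (1/3) ^ n * enorm A E (v n)"
      using vpos[of n] enorm_squared[of "v n"]
      by (simp only: inner_scale_right[OF vc vc] norm_scale[OF inner_closed[OF vc vc]] k)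
        (simp add: power2_eq_square flip: enorm_squared)
    then have "2 * ((1/3) ^ n * enorm A E (v n)) = anorm A (ascale A 2 (einner E (v n) ?e))"
      by (simp add: norm_scale)
    \<comment> \<open>Both \<open>x + e\<close> and \<open>x - e\<close> are admissible new points.
      Since their inner products with \<open>v n\<close> differ by
      \<open>2 \<langle>v n, e\<rangle>\<close>, at least one of these has norm at least that of
      \<open>\<langle>v n, e\<rangle>\<close>.\<close>
    also have "ascale A 2 (einner E (v n) ?e) = einner E (v n) (x + ?e) - einner E (v n) (x - ?e)"
      using x scale_left_distrib[of 1 1 "einner E (v n) ?e"] by (simp add: inner_add_right inner_diff_right)
    also have "anorm A \<dots> \<le> anorm A (einner E (v n) (x + ?e)) + anorm A (einner E (v n) (x - ?e))"
      using x by (intro norm_diff) auto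
    finally have "(1/3) ^ n * enorm A E (v n) \<le> anorm A (einner E (v n) (x + ?e))
        \<or> (1/3) ^ n * enorm A E (v n) \<le> anorm A (einner E (v n) (x - ?e))" by linarith
    moreover have "x + ?e - x = ?e" "x - ?e - x = - ?e" by simp_all
    then have "enorm A E (x + ?e - x) \<le> (1/3) ^ n" "enorm A E (x - ?e - x) \<le> (1/3) ^ n"
      using e by (simp_all only: enorm_minus E_closed vc)
    ultimately show ?thesis using x vc by (metis E_closed(2-4))
  qed
  then have "\<forall>n x. \<exists>x'. x \<in> ecarrier E \<longrightarrow> x' \<in> ecarrier E \<and> enorm A E (x' - x) \<le> (1/3) ^ n \<and>
      (1/3) ^ n * enorm A E (v n) \<le> anorm A (einner E (v n) x')" by blast
  then obtain f where "\<forall>n x. x \<in> ecarrier E \<longrightarrow> f n x \<in> ecarrier E \<and> enorm A E (f n x - x) \<le> (1/3) ^ n \<and>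
      (1/3) ^ n * enorm A E (v n) \<le> anorm A (einner E (v n) (f n x))" by metis
  then have f: "f n x \<in> ecarrier E" "enorm A E (f n x - x) \<le> (1/3) ^ n"
      "(1/3) ^ n * enorm A E (v n) \<le> anorm A (einner E (v n) (f n x))" if "x \<in> ecarrier E" for n x
    using that by blast+
  define X where "X = rec_nat 0 f"
  have X0: "X 0 = 0" and XS: "X (Suc n) = f n (X n)" for n by (simp_all add: X_def)
  have Xc [simp]: "X n \<in> ecarrier E" for n by (induction n) (auto simp: X0 XS f)
  \<comment> \<open>The exact partial sum of the steps, a geometric series with ratio 1/3; this form
    closes the induction.\<close>
  have X_diff: "enorm A E (X (n + k) - X n) \<le> 3/2 * ((1/3) ^ n - (1/3) ^ (n + k))" for n k
  proof (induction k)
    case (Suc k)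
    have "enorm A E (X (n + Suc k) - X n) \<le> enorm A E (X (Suc (n + k)) - X (n + k)) + enorm A E (X (n + k) - X n)"
      using enorm_diff_triangle[of "X (n + Suc k)" "X (n + k)" "X n"] by simp
    also have "\<dots> \<le> (1/3) ^ (n + k) + 3/2 * ((1/3) ^ n - (1/3) ^ (n + k))"
      using f(2)[OF Xc[of "n + k"], of "n + k"] unfolding XS by (intro add_mono Suc)
    also have "\<dots> = 3/2 * ((1/3) ^ n - (1/3) ^ (n + Suc k))" by (simp add: field_simps)
    finally show ?case .
  qed simp
  have X_close: "enorm A E (X m - X n) \<le> 3/2 * (1/3) ^ N" if "N \<le> m" "N \<le> n" for m n N
  proof -
    have le: "enorm A E (X m - X n) \<le> 3/2 * (1/3) ^ N" if "N \<le> n" "n \<le> m" for m n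
    proof -
      have "enorm A E (X m - X n) \<le> 3/2 * (1/3) ^ n"
        using X_diff[of n "m - n"] that by (auto elim: order_trans)
      also have "\<dots> \<le> 3/2 * (1/3) ^ N" using that by (simp add: power_decreasing)
      finally show ?thesis .
    qed
    then show ?thesis using that le[of n m] le[of m n] enorm_diff_commute[of "X m" "X n"] by (cases "n \<le> m") auto
  qed
  have "\<exists>N. \<forall>m\<ge>N. \<forall>n\<ge>N. enorm A E (X m - X n) < \<epsilon>" if eps: "\<epsilon> > 0" for \<epsilon>
  proof -
    obtain N where "(1/3::real) ^ N < 2/3 * \<epsilon>"
      using real_arch_pow_inv[of "2/3 * \<epsilon>" "1/3"] eps by auto
    then have "enorm A E (X m - X n) < \<epsilon>" if "m \<ge> N" "n \<ge> N" for m n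
      using X_close[OF that] by simp
    then show ?thesis by blast
  qed
  then obtain x where x: "x \<in> ecarrier E" and lim: "(\<lambda>n. enorm A E (X n - x)) \<longlonglongrightarrow> 0"
    using ecomplete unfolding norm_complete_def by (metis Xc image_subsetI)
  have Xx: "enorm A E (X n - x) \<le> 3/2 * (1/3) ^ n" for n
  proof (rule LIMSEQ_le_const)
    show "(\<lambda>m. 3/2 * (1/3) ^ n + enorm A E (X m - x)) \<longlonglongrightarrow> 3/2 * (1/3) ^ n"
      using tendsto_add[OF tendsto_const lim] by simp
    have "enorm A E (X n - x) \<le> 3/2 * (1/3) ^ n + enorm A E (X m - x)" if "m \<ge> n" for m
      using enorm_diff_triangle[of "X n" "X m" x] X_close[of n n m] that x by simp
    then show "\<exists>N. \<forall>m\<ge>N. enorm A E (X n - x) \<le> 3/2 * (1/3) ^ n + enorm A E (X m - x)" by blast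
  qed
  have "(4/3) ^ n \<le> 2 * enorm A E (R x)" for n
  proof -
    \<comment> \<open>\<open>X (Suc n)\<close> is the point that carries hump \<open>n\<close>. The
      limit \<open>x\<close> is at most \<open>3/2 * (1/3) ^ Suc n\<close> away, half of
      \<open>(1/3) ^ n\<close>, so at least half of the hump survives at \<open>x\<close>.\<close>
    have "einner E (v n) (X (Suc n)) = einner E (v n) (X (Suc n) - x) + einner E (v n) x"
      using x by (simp add: inner_diff_right)
    then have "anorm A (einner E (v n) (X (Suc n))) \<le> anorm A (einner E (v n) (X (Suc n) - x)) + anorm A (einner E (v n) x)"
      using x by (simp add: norm_triangle)
    also have "anorm A (einner E (v n) (X (Suc n) - x)) \<le> enorm A E (v n) * (3/2 * (1/3) ^ Suc n)"
      using x vpos[of n] Xx[of "Suc n"] by (intro order_trans[OF cauchy_schwarz] mult_left_mono) auto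
    also have "anorm A (einner E (v n) x) \<le> enorm A E (R x)"
    proof -
      have "anorm A (einner E (v n) x) \<le> enorm A E (Y n) * enorm A E (R x)"
        unfolding v_def using norm_inner_adjoint[OF p Y(1) x] .
      also have "\<dots> \<le> 1 * enorm A E (R x)"
        using Y(2)[of n] enorm_nonneg[of "R x"] c x by (intro mult_right_mono) auto
      finally show ?thesis by simp
    qed
    finally have "(1/3) ^ n * enorm A E (v n) \<le> enorm A E (v n) * (3/2 * (1/3) ^ Suc n) + enorm A E (R x)"
      using f(3)[OF Xc[of n], of n] by (simp add: XS)
    moreover have "enorm A E (v n) * (3/2 * (1/3) ^ Suc n) = ((1/3) ^ n * enorm A E (v n)) / 2" by simp
    ultimately have "(1/3) ^ n * enorm A E (v n) \<le> 2 * enorm A E (R x)" by linarith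
    moreover have "(1/3) ^ n * 4 ^ n \<le> (1/3) ^ n * enorm A E (v n)"
      using v4[of n] by (intro mult_left_mono) auto
    moreover have "(4/3::real) ^ n = (1/3) ^ n * 4 ^ n" by (simp flip: power_mult_distrib)
    ultimately show ?thesis by linarith
  qed
  moreover obtain n where "2 * enorm A E (R x) < (4/3) ^ n" using real_arch_pow[of "4/3" "2 * enorm A E (R x)"] by auto
  ultimately show False by (meson linorder_not_le)
qed

section \<open>The operator norm of adjoint pairs\<close>

lemma bdd_above_unit_ball:
  assumes p: "adjoint_pair E s T R"
  shows "bdd_above ((\<lambda>x. enorm A E (T x)) ` {x \<in> ecarrier E. enorm A E x \<le> 1})"
proof -
  obtain C where C: "C \<ge> 0" "\<And>x. x \<in> ecarrier E \<Longrightarrow> enorm A E (T x) \<le> C * enorm A E x"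
    using adjoint_pair_bounded[OF p] by blast
  show ?thesis
  proof (rule bdd_aboveI2)
    fix x assume "x \<in> {x \<in> ecarrier E. enorm A E x \<le> 1}"
    then show "enorm A E (T x) \<le> C"
      using C(2)[of x] mult_left_mono[of "enorm A E x" 1 C] C(1) by simp
  qed
qed

lemma op_norm_nonneg:
  assumes p: "adjoint_pair E s T R" shows "0 \<le> op_norm A E T"
  unfolding op_norm_def
  using cSUP_upper[OF _ bdd_above_unit_ball[OF p], of 0] adjoint_pair_map_zero[OF p] by simp

lemma op_norm_bound:
  assumes p: "adjoint_pair E s T R" and x: "x \<in> ecarrier E"
  shows "enorm A E (T x) \<le> op_norm A E T * enorm A E x"
proof (cases "x = 0")
  case False
  then have pos: "enorm A E x > 0" using x enorm_nonneg[of x] enorm_eq_0_iff[of x] by linarith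
  let ?k = "complex_of_real (1 / enorm A E x)"
  have k: "cmod ?k = 1 / enorm A E x" using pos by (simp add: norm_divide)
  have "enorm A E (escale E ?k x) = 1" using x pos by (simp only: enorm_scale k) simp
  then have "enorm A E (T (escale E ?k x)) \<le> op_norm A E T"
    unfolding op_norm_def using x by (intro cSUP_upper[OF _ bdd_above_unit_ball[OF p]]) simp
  also have "enorm A E (T (escale E ?k x)) = enorm A E (T x) / enorm A E x"
    by (simp only: adjoint_pair_map_scale[OF p x] enorm_scale[OF adjoint_pair_closed(1)[OF p x]] \<sigma>_norm k) simp
  finally show ?thesis using pos by (simp add: field_simps)
qed (simp add: adjoint_pair_map_zero[OF p])

lemma op_norm_le:
  assumes "C \<ge> 0" "\<And>x. x \<in> ecarrier E \<Longrightarrow> enorm A E (T x) \<le> C * enorm A E x"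
  shows "op_norm A E T \<le> C"
  unfolding op_norm_def
proof (rule cSUP_least)
  have "0 \<in> {x \<in> ecarrier E. enorm A E x \<le> 1}" by simp
  then show "{x \<in> ecarrier E. enorm A E x \<le> 1} \<noteq> {}" by blast
  fix x assume "x \<in> {x \<in> ecarrier E. enorm A E x \<le> 1}"
  then show "enorm A E (T x) \<le> C"
    using assms(2)[of x] mult_left_mono[of "enorm A E x" 1 C] assms(1) by simp
qed

text \<open>From \<open>\<parallel>R x\<parallel>\<^sup>2 \<le> \<parallel>x\<parallel> \<parallel>T
  (R x)\<parallel> \<le> \<parallel>T\<parallel> \<parallel>x\<parallel> \<parallel>R
  x\<parallel>\<close> one factor is cancelled.\<close>

lemma op_norm_adjoint_le:
  assumes p: "adjoint_pair E s T R" shows "op_norm A E R \<le> op_norm A E T"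
proof (rule op_norm_le[OF op_norm_nonneg[OF p]])
  fix x assume x: "x \<in> ecarrier E"
  note c = adjoint_pair_closed[OF p]
  have "(enorm A E (R x))\<^sup>2 = anorm A (einner E (R x) (R x))" using c x by (simp add: enorm_squared)
  also have "\<dots> \<le> enorm A E x * enorm A E (T (R x))"
    using norm_inner_adjoint[OF adjoint_pair_sym[OF p] x] c x by simp
  also have "\<dots> \<le> enorm A E x * (op_norm A E T * enorm A E (R x))"
    using op_norm_bound[OF p] c x enorm_nonneg by (intro mult_left_mono) auto
  finally have *: "enorm A E (R x) * enorm A E (R x) \<le> (op_norm A E T * enorm A E x) * enorm A E (R x)"
    by (simp add: power2_eq_square mult_ac)
  show "enorm A E (R x) \<le> op_norm A E T * enorm A E x"
  proof (cases "enorm A E (R x) = 0")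
    case True
    then show ?thesis using op_norm_nonneg[OF p] enorm_nonneg[OF x] by simp
  next
    case False
    then have "enorm A E (R x) > 0" using enorm_nonneg[of "R x"] c x by (simp add: less_le)
    then show ?thesis using * by simp
  qed
qed

lemma op_norm_adjoint:
  assumes "adjoint_pair E s T R" shows "op_norm A E R = op_norm A E T"
  using op_norm_adjoint_le[OF assms] op_norm_adjoint_le[OF adjoint_pair_sym[OF assms]] by simp

lemma op_norm_adjoint_comp:
  assumes p: "adjoint_pair E s T R" shows "op_norm A E (R \<circ> T) = (op_norm A E T)\<^sup>2"
proof (rule antisym)
  note c = adjoint_pair_closed[OF p] and n = op_norm_nonneg[OF p]
  note q = adjoint_pair_sym[OF p]
  have RT: "enorm A E ((R \<circ> T) x) \<le> (op_norm A E T)\<^sup>2 * enorm A E x" if x: "x \<in> ecarrier E" for x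
  proof -
    have "enorm A E (R (T x)) \<le> op_norm A E T * enorm A E (T x)"
      using op_norm_bound[OF q, of "T x"] op_norm_adjoint[OF p] c x by simp
    also have "\<dots> \<le> op_norm A E T * (op_norm A E T * enorm A E x)"
      using op_norm_bound[OF p x] n by (intro mult_left_mono)
    finally show ?thesis by (simp add: power2_eq_square mult_ac)
  qed
  then show "op_norm A E (R \<circ> T) \<le> (op_norm A E T)\<^sup>2" by (intro op_norm_le) auto
  \<comment> \<open>The composite has an adjoint with respect to \<open>s \<circ> s\<close>, in
    general not \<open>s\<close>, so its supremum is handled directly instead of by
    \<open>op_norm_bound\<close>.\<close>
  have up: "enorm A E (R (T x)) \<le> op_norm A E (R \<circ> T)" if x: "x \<in> ecarrier E" "enorm A E x \<le> 1" for x
  proof -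
    have "bdd_above ((\<lambda>x. enorm A E ((R \<circ> T) x)) ` {x \<in> ecarrier E. enorm A E x \<le> 1})"
    proof (rule bdd_aboveI2)
      fix x assume "x \<in> {x \<in> ecarrier E. enorm A E x \<le> 1}"
      then show "enorm A E ((R \<circ> T) x) \<le> (op_norm A E T)\<^sup>2"
        using RT[of x] mult_left_mono[of "enorm A E x" 1 "(op_norm A E T)\<^sup>2"] by simp
    qed
    from cSUP_upper[OF _ this, of x] show ?thesis using x unfolding op_norm_def by simp
  qed
  have nn: "0 \<le> op_norm A E (R \<circ> T)"
    using up[of 0] adjoint_pair_map_zero[OF p] adjoint_pair_map_zero[OF q] by simp
  have "op_norm A E T \<le> sqrt (op_norm A E (R \<circ> T))"
    unfolding op_norm_def[of A E T]
  proof (rule cSUP_least)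
    have "0 \<in> {x \<in> ecarrier E. enorm A E x \<le> 1}" by simp
    then show "{x \<in> ecarrier E. enorm A E x \<le> 1} \<noteq> {}" by blast
    fix x assume "x \<in> {x \<in> ecarrier E. enorm A E x \<le> 1}"
    then have x: "x \<in> ecarrier E" "enorm A E x \<le> 1" by auto
    have "(enorm A E (T x))\<^sup>2 \<le> enorm A E x * enorm A E (R (T x))"
      using norm_inner_adjoint[OF p x(1), of "T x"] c x by (simp add: enorm_squared)
    also have "\<dots> \<le> 1 * op_norm A E (R \<circ> T)"
      using x up[OF x] c enorm_nonneg by (intro mult_mono) auto
    finally show "enorm A E (T x) \<le> sqrt (op_norm A E (R \<circ> T))"
      by (simp add: real_le_rsqrt)
  qed
  then show "(op_norm A E T)\<^sup>2 \<le> op_norm A E (R \<circ> T)"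
    using n nn by (metis real_sqrt_le_iff real_sqrt_unique real_le_rsqrt sqrt_le_D)
qed

lemma op_norm_zero: "op_norm A E 0 = 0"
  using op_norm_le[of 0 0] op_norm_nonneg[OF adjoint_pair_zero] by simp

lemma op_norm_eq_0_iff:
  assumes p: "adjoint_pair E s T R" shows "op_norm A E T = 0 \<longleftrightarrow> T = 0"
proof
  assume z: "op_norm A E T = 0"
  show "T = 0"
  proof (rule carrier_maps_eqI[OF adjoint_pair_maps(1)[OF p], of 0])
    fix x assume x: "x \<in> ecarrier E"
    have "enorm A E (T x) = 0"
      using op_norm_bound[OF p x] enorm_nonneg[of "T x"] adjoint_pair_closed[OF p x] z by simp
    then show "T x = 0 x" using enorm_eq_0_iff adjoint_pair_closed[OF p x] by simp
  qed (simp add: carrier_maps_def)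
qed (simp add: op_norm_zero)

lemma op_norm_triangle:
  assumes p: "adjoint_pair E s T R" and q: "adjoint_pair E s T' R'"
  shows "op_norm A E (T + T') \<le> op_norm A E T + op_norm A E T'"
proof (rule op_norm_le)
  fix x assume x: "x \<in> ecarrier E"
  show "enorm A E ((T + T') x) \<le> (op_norm A E T + op_norm A E T') * enorm A E x"
    using enorm_triangle[of "T x" "T' x"] op_norm_bound[OF p x] op_norm_bound[OF q x] adjoint_pair_closed[OF p x]
      adjoint_pair_closed[OF q x] by (simp add: algebra_simps)
qed (use op_norm_nonneg p q in auto)

lemma op_norm_scale:
  assumes p: "adjoint_pair E s T R"
  shows "op_norm A E (\<lambda>x. escale E c (T x)) = cmod c * op_norm A E T"
proof -
  have le: "op_norm A E (\<lambda>x. escale E c (T x)) \<le> cmod c * op_norm A E T" if p: "adjoint_pair E s T R" for T R c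
  proof (rule op_norm_le)
    fix x assume x: "x \<in> ecarrier E"
    show "enorm A E (escale E c (T x)) \<le> cmod c * op_norm A E T * enorm A E x"
      using op_norm_bound[OF p x] adjoint_pair_closed[OF p x] by (simp add: enorm_scale mult.assoc mult_left_mono)
  qed (use op_norm_nonneg[OF p] in simp)
  show ?thesis
  proof (cases "c = 0")
    case True
    then show ?thesis using op_norm_zero by (simp add: zero_fun_def)
  next
    case False
    have "op_norm A E T \<le> cmod (1/c) * op_norm A E (\<lambda>x. escale E c (T x))"
      using le[OF adjoint_pair_scale[OF p, of c], of "1/c"] False by simp
    then have "cmod c * op_norm A E T \<le> op_norm A E (\<lambda>x. escale E c (T x))"
      using False by (simp add: norm_divide field_simps)
    then show ?thesis using le[OF p, of c] by simp
  qed
qed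

lemma pointwise_limit:
  assumes p: "\<And>n. adjoint_pair E s (T n) (R n)"
    and cauchy: "\<And>\<epsilon>. \<epsilon> > 0 \<Longrightarrow> \<exists>N. \<forall>m\<ge>N. \<forall>n\<ge>N. op_norm A E (T m - T n) < \<epsilon>"
  obtains L where "L \<in> carrier_maps E" "\<And>x. x \<in> ecarrier E \<Longrightarrow> (\<lambda>n. enorm A E (T n x - L x)) \<longlonglongrightarrow> 0"
proof -
  have "\<exists>y\<in>ecarrier E. (\<lambda>n. enorm A E (T n x - y)) \<longlonglongrightarrow> 0" if x: "x \<in> ecarrier E" for x
  proof -
    have bound: "enorm A E (T m x - T n x) \<le> op_norm A E (T m - T n) * enorm A E x" for m n
      using op_norm_bound[OF adjoint_pair_diff[OF p p] x, of m n] by simp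
    have "\<exists>N. \<forall>m\<ge>N. \<forall>n\<ge>N. enorm A E (T m x - T n x) < \<epsilon>" if eps: "\<epsilon> > 0" for \<epsilon>
    proof -
      \<comment> \<open>The added 1 keeps the divisor positive at \<open>x = 0\<close>.\<close>
      have pos: "enorm A E x + 1 > 0" using enorm_nonneg[OF x] by simp
      obtain N where N: "\<And>m n. m \<ge> N \<Longrightarrow> n \<ge> N \<Longrightarrow> op_norm A E (T m - T n) < \<epsilon> / (enorm A E x + 1)"
        using cauchy[of "\<epsilon> / (enorm A E x + 1)"] eps pos by auto
      have "enorm A E (T m x - T n x) < \<epsilon>" if "m \<ge> N" "n \<ge> N" for m n
      proof -
        have "enorm A E (T m x - T n x) \<le> op_norm A E (T m - T n) * (enorm A E x + 1)"
          using bound[of m n] op_norm_nonneg[OF adjoint_pair_diff[OF p p], of m n] by (simp add: algebra_simps)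
        also have "\<dots> < \<epsilon>" using N[OF that] pos by (simp add: field_simps)
        finally show ?thesis .
      qed
      then show ?thesis by blast
    qed
    then show ?thesis
      using ecomplete adjoint_pair_closed[OF p x] unfolding norm_complete_def
      by (auto dest!: spec[of _ "\<lambda>n. T n x"])
  qed
  then obtain l where l: "\<And>x. x \<in> ecarrier E \<Longrightarrow> l x \<in> ecarrier E"
    "\<And>x. x \<in> ecarrier E \<Longrightarrow> (\<lambda>n. enorm A E (T n x - l x)) \<longlonglongrightarrow> 0" by metis
  show thesis
    by (rule that[of "\<lambda>x. if x \<in> ecarrier E then l x else 0"]) (use l in \<open>auto simp: carrier_maps_def\<close>)
qed

text \<open>Taking adjoints is isometric, so the adjoints \<open>R n\<close> form a Cauchy sequence
  too, and their pointwise limit \<open>K\<close> is an adjoint of the pointwise limit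
  \<open>L\<close>. Norm convergence follows by letting \<open>m\<close> grow in the Cauchy
  estimate.\<close>

lemma op_norm_complete: "norm_complete {T. \<exists>R. adjoint_pair E s T R} (op_norm A E)"
  unfolding norm_complete_def
proof (intro allI impI, elim conjE)
  fix T :: "nat \<Rightarrow> 'e \<Rightarrow> 'e"
  assume "range T \<subseteq> {T. \<exists>R. adjoint_pair E s T R}"
    and cauchy: "\<forall>\<epsilon>>0. \<exists>N. \<forall>m\<ge>N. \<forall>n\<ge>N. op_norm A E (T m - T n) < \<epsilon>"
  then have "\<forall>n. \<exists>R. adjoint_pair E s (T n) R" by auto
  then obtain R where p: "\<And>n. adjoint_pair E s (T n) (R n)" by metis
  note c = adjoint_pair_closed[OF p]
  obtain L where L: "L \<in> carrier_maps E" and limL: "\<And>x. x \<in> ecarrier E \<Longrightarrow> (\<lambda>n. enorm A E (T n x - L x)) \<longlonglongrightarrow> 0"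
    using pointwise_limit[of T R] p cauchy by blast
  have "\<exists>N. \<forall>m\<ge>N. \<forall>n\<ge>N. op_norm A E (R m - R n) < \<epsilon>" if "\<epsilon> > 0" for \<epsilon>
    using cauchy that op_norm_adjoint[OF adjoint_pair_diff[OF p p]] by simp
  then obtain K where K: "K \<in> carrier_maps E" and limK: "\<And>x. x \<in> ecarrier E \<Longrightarrow> (\<lambda>n. enorm A E (R n x - K x)) \<longlonglongrightarrow> 0"
    using pointwise_limit[of R T] adjoint_pair_sym[OF p] by blast
  note LK = carrier_maps_closed[OF L] carrier_maps_closed[OF K]
  have pL: "adjoint_pair E s L K"
    unfolding adjoint_pair_def
  proof (intro conjI ballI L K)
    fix x y assume x: "x \<in> ecarrier E" and y: "y \<in> ecarrier E"
    show "einner E (L x) y = s (einner E x (K y))"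
    proof (rule eq_if_norm_diff_null)
      fix n
      have "einner E (L x) y - s (einner E x (K y)) = s (einner E x (R n y - K y)) - einner E (T n x - L x) y"
        using x y LK c adjoint_pairD[OF p x y] by (simp add: inner_diff_left inner_diff_right s_diff)
      also have "anorm A \<dots> \<le> anorm A (s (einner E x (R n y - K y))) + anorm A (einner E (T n x - L x) y)"
        using x y LK c by (intro norm_diff) auto
      also have "\<dots> \<le> enorm A E x * enorm A E (R n y - K y) + enorm A E (T n x - L x) * enorm A E y"
        using x y LK c by (simp add: s_norm add_mono cauchy_schwarz)
      finally show "anorm A (einner E (L x) y - s (einner E x (K y)))
        \<le> enorm A E x * enorm A E (R n y - K y) + enorm A E (T n x - L x) * enorm A E y" .
    next
      show "(\<lambda>n. enorm A E x * enorm A E (R n y - K y) + enorm A E (T n x - L x) * enorm A E y) \<longlonglongrightarrow> 0"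
        using tendsto_add[OF tendsto_mult_left[OF limK[OF y]] tendsto_mult_right[OF limL[OF x]]] by simp
    qed (use x y LK in auto)
  qed
  have "(\<lambda>n. op_norm A E (T n - L)) \<longlonglongrightarrow> 0"
  proof (rule LIMSEQ_I)
    fix \<epsilon> :: real assume eps: "\<epsilon> > 0"
    obtain N where N: "\<And>m n. m \<ge> N \<Longrightarrow> n \<ge> N \<Longrightarrow> op_norm A E (T m - T n) < \<epsilon>/2"
      using cauchy eps by (meson half_gt_zero)
    have "op_norm A E (T n - L) \<le> \<epsilon>/2" if n: "n \<ge> N" for n
    proof (rule op_norm_le)
      fix x assume x: "x \<in> ecarrier E"
      show "enorm A E ((T n - L) x) \<le> \<epsilon>/2 * enorm A E x"
      proof (rule LIMSEQ_le_const)
        show "(\<lambda>m. \<epsilon>/2 * enorm A E x + enorm A E (T m x - L x)) \<longlonglongrightarrow> \<epsilon>/2 * enorm A E x"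
          using tendsto_add[OF tendsto_const limL[OF x]] by simp
        have "enorm A E ((T n - L) x) \<le> \<epsilon>/2 * enorm A E x + enorm A E (T m x - L x)" if m: "m \<ge> N" for m
        proof -
          have "enorm A E (T n x - T m x) \<le> op_norm A E (T n - T m) * enorm A E x"
            using op_norm_bound[OF adjoint_pair_diff[OF p p] x] by simp
          also have "\<dots> \<le> \<epsilon>/2 * enorm A E x"
            using N[OF n m] enorm_nonneg[OF x] by (intro mult_right_mono) auto
          finally show ?thesis
            using enorm_diff_triangle[of "T n x" "T m x" "L x"] c x LK by simp
        qed
        then show "\<exists>N. \<forall>m\<ge>N. enorm A E ((T n - L) x) \<le> \<epsilon>/2 * enorm A E x + enorm A E (T m x - L x)" by blast
      qed
    qed (use eps in simp)
    then show "\<exists>N. \<forall>n\<ge>N. norm (op_norm A E (T n - L) - 0) < \<epsilon>"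
      using eps op_norm_nonneg[OF adjoint_pair_diff[OF p pL]] by force
  qed
  then show "\<exists>L\<in>{T. \<exists>R. adjoint_pair E s T R}. (\<lambda>n. op_norm A E (T n - L)) \<longlonglongrightarrow> 0"
    using pL by blast
qed

end

section \<open>The unital algebra of adjointable operators\<close>

lemma carrier_maps_range:
  fixes E :: "('a, 'e::ab_group_add) hmod_struct"
  assumes "0 \<in> ecarrier E" "T \<in> carrier_maps E" shows "T x \<in> ecarrier E"
  using assms by (cases "x \<in> ecarrier E") (auto simp: carrier_maps_def)

text \<open>Twists compose along with the operators. The conditions at 0 keep the composites zero
  off the carrier, where the inner factor returns 0.\<close>

lemma adjoint_pair_comp:
  assumes p: "adjoint_pair E s T R" "T 0 = 0" and q: "adjoint_pair E s' S Q" "Q 0 = 0"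
  shows "adjoint_pair E (s \<circ> s') (T \<circ> S) (Q \<circ> R)"
  using p q unfolding adjoint_pair_def carrier_maps_def by simp

text \<open>Used to replace \<open>\<sharp> \<circ> \<sharp>\<close> by \<open>id\<close>, with
  which it agrees on the carrier of \<open>A\<close>.\<close>

lemma adjoint_pair_cong:
  assumes "hilbert_module A E" "adjoint_pair E s T R" "\<And>a. a \<in> acarrier A \<Longrightarrow> s a = s' a"
  shows "adjoint_pair E s' T R"
  using assms(2,3) hilbert_module.inner_closed[OF assms(1)] unfolding adjoint_pair_def
  by (simp add: carrier_maps_closed)

context cauchy_schwarz_module
begin

lemma twisted_id: "twisted_module A E id id"
  by unfold_locales auto

lemma vector_space_pointwise:
  "vector_space (\<lambda>c (T :: 'e \<Rightarrow> 'e) x. escale E c (T x))"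
  by unfold_locales
    (auto simp: fun_eq_iff E.scale_right_distrib E.scale_left_distrib)

text \<open>The identity, cut off so as to represent a map on the carrier.\<close>

definition one_op :: "'e \<Rightarrow> 'e" where
  "one_op x = (if x \<in> ecarrier E then x else 0)"

lemma adjoint_pair_one_op: "adjoint_pair E id one_op one_op"
  by (auto simp: adjoint_pair_def carrier_maps_def one_op_def)

lemma acarrier_adjointable: "acarrier (adjointable_algebra A E) = {T. \<exists>R. adjoint_pair E id T R}"
proof -
  interpret twisted_module A E id id by (rule twisted_id)
  have "T \<in> linear_ops E \<and> (\<exists>R. is_adjoint E T R) \<longleftrightarrow> (\<exists>R. adjoint_pair E id T R)" for T
  proof
    assume "\<exists>R. adjoint_pair E id T R"
    then obtain R where p: "adjoint_pair E id T R" ..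
    show "T \<in> linear_ops E \<and> (\<exists>R. is_adjoint E T R)"
      using p adjoint_pair_semilinear[OF p] unfolding linear_ops_def is_adjoint_def adjoint_pair_def id_def by blast
  qed (auto simp: linear_ops_def is_adjoint_def adjoint_pair_def)
  then show ?thesis by (simp add: adjointable_algebra_def)
qed

lemma astar_adjointable:
  assumes p: "adjoint_pair E id T R" shows "astar (adjointable_algebra A E) T = R"
proof -
  interpret twisted_module A E id id by (rule twisted_id)
  have "is_adjoint E T R' \<longleftrightarrow> adjoint_pair E id T R'" for R'
    using p by (auto simp: is_adjoint_def adjoint_pair_def)
  then have "(THE R. is_adjoint E T R) = R"
    using p adjoint_pair_unique[OF p] by (intro the_equality) blast+
  then show ?thesis by (simp add: adjointable_algebra_def)
qed

lemma adjointable_algebra_simps: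
  "ascale (adjointable_algebra A E) = (\<lambda>c T x. escale E c (T x))"
  "amult (adjointable_algebra A E) = (\<circ>)"
  "anorm (adjointable_algebra A E) = op_norm A E"
  by (simp_all add: adjointable_algebra_def)

theorem adjointable_algebra_unital: "unital_cstar_algebra (adjointable_algebra A E) one_op"
proof -
  interpret twisted_module A E id id by (rule twisted_id)
  interpret F: vector_space "\<lambda>c (T :: 'e \<Rightarrow> 'e) x. escale E c (T x)" by (rule vector_space_pointwise)
  let ?L = "adjointable_algebra A E"
  note simps = acarrier_adjointable adjointable_algebra_simps
  have comp: "adjoint_pair E id (T \<circ> S) (Q \<circ> R)" if p: "adjoint_pair E id T R" and q: "adjoint_pair E id S Q" for T R S Q
    using adjoint_pair_comp[OF p adjoint_pair_map_zero[OF p] q adjoint_pair_map_zero[OF adjoint_pair_sym[OF q]]]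
    by simp
  have rng: "T x \<in> ecarrier E" if "adjoint_pair E id T R" for T R x
    using carrier_maps_range adjoint_pair_maps(1)[OF that] by blast
  show ?thesis
  proof (intro unital_cstar_algebra.intro unital_cstar_algebra_axioms.intro cstar_algebra.intro cstar_algebra_axioms.intro)
    show "vector_space (ascale ?L)" unfolding simps by (rule vector_space_pointwise)
    show "module.subspace (ascale ?L) (acarrier ?L)"
      unfolding simps F.subspace_def using adjoint_pair_zero adjoint_pair_add adjoint_pair_scale by blast
    show "norm_complete (acarrier ?L) (anorm ?L)" unfolding simps by (rule op_norm_complete)
    show "one_op \<in> acarrier ?L" unfolding simps using adjoint_pair_one_op by blast
  next
    fix T S U c
    assume "T \<in> acarrier ?L"
    then obtain R where p: "adjoint_pair E id T R" unfolding simps by blast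
    note pm = adjoint_pair_sym[OF p]
    show "0 \<le> anorm ?L T" unfolding simps by (rule op_norm_nonneg[OF p])
    show "anorm ?L T = 0 \<longleftrightarrow> T = 0" unfolding simps by (rule op_norm_eq_0_iff[OF p])
    show "anorm ?L (ascale ?L c T) = cmod c * anorm ?L T" unfolding simps by (rule op_norm_scale[OF p])
    show "astar ?L T \<in> acarrier ?L" using astar_adjointable[OF p] pm unfolding simps by auto
    show "astar ?L (astar ?L T) = T" using astar_adjointable[OF p] astar_adjointable[OF pm] by simp
    show "astar ?L (ascale ?L c T) = ascale ?L (cnj c) (astar ?L T)"
      using astar_adjointable[OF adjoint_pair_scale[OF p, of c]] astar_adjointable[OF p] unfolding simps by simp
    show "anorm ?L (astar ?L T \<odot>\<^bsub>?L\<^esub> T) = (anorm ?L T)\<^sup>2"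
      using op_norm_adjoint_comp[OF p] astar_adjointable[OF p] unfolding simps by simp
    show "one_op \<odot>\<^bsub>?L\<^esub> T = T" unfolding simps using rng[OF p] by (auto simp: one_op_def)
    show "T \<odot>\<^bsub>?L\<^esub> one_op = T"
      unfolding simps using adjoint_pair_map_zero[OF p] carrier_maps_outside[OF adjoint_pair_maps(1)[OF p]]
      by (auto simp: one_op_def)
    assume "S \<in> acarrier ?L"
    then obtain Q where q: "adjoint_pair E id S Q" unfolding simps by blast
    show "anorm ?L (T + S) \<le> anorm ?L T + anorm ?L S" unfolding simps by (rule op_norm_triangle[OF p q])
    show "T \<odot>\<^bsub>?L\<^esub> S \<in> acarrier ?L" unfolding simps using comp[OF p q] by blast
    show "ascale ?L c T \<odot>\<^bsub>?L\<^esub> S = ascale ?L c (T \<odot>\<^bsub>?L\<^esub> S)" unfolding simps by auto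
    show "T \<odot>\<^bsub>?L\<^esub> ascale ?L c S = ascale ?L c (T \<odot>\<^bsub>?L\<^esub> S)"
      unfolding simps using adjoint_pair_map_scale[OF p] rng[OF q] by auto
    show "astar ?L (T + S) = astar ?L T + astar ?L S"
      using astar_adjointable[OF p] astar_adjointable[OF q] astar_adjointable[OF adjoint_pair_add[OF p q]] by simp
    show "astar ?L (T \<odot>\<^bsub>?L\<^esub> S) = astar ?L S \<odot>\<^bsub>?L\<^esub> astar ?L T"
      using astar_adjointable[OF p] astar_adjointable[OF q] astar_adjointable[OF comp[OF p q]] unfolding simps by simp
    show "anorm ?L (T \<odot>\<^bsub>?L\<^esub> S) \<le> anorm ?L T * anorm ?L S"
      unfolding simps
    proof (rule op_norm_le)
      fix x assume x: "x \<in> ecarrier E"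
      have "enorm A E (T (S x)) \<le> op_norm A E T * enorm A E (S x)" by (rule op_norm_bound[OF p rng[OF q]])
      also have "\<dots> \<le> op_norm A E T * (op_norm A E S * enorm A E x)"
        by (intro mult_left_mono op_norm_bound[OF q x] op_norm_nonneg[OF p])
      finally show "enorm A E ((T \<circ> S) x) \<le> op_norm A E T * op_norm A E S * enorm A E x" by simp
    qed (use op_norm_nonneg p q in auto)
    assume "U \<in> acarrier ?L"
    then obtain V where r: "adjoint_pair E id U V" unfolding simps by blast
    show "T \<odot>\<^bsub>?L\<^esub> S \<odot>\<^bsub>?L\<^esub> U = T \<odot>\<^bsub>?L\<^esub> (S \<odot>\<^bsub>?L\<^esub> U)" unfolding simps by (simp add: o_assoc)
    show "(T + S) \<odot>\<^bsub>?L\<^esub> U = T \<odot>\<^bsub>?L\<^esub> U + S \<odot>\<^bsub>?L\<^esub> U" unfolding simps by auto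
    show "T \<odot>\<^bsub>?L\<^esub> (S + U) = T \<odot>\<^bsub>?L\<^esub> S + T \<odot>\<^bsub>?L\<^esub> U"
      unfolding simps using adjoint_pair_map_add[OF p rng[OF q] rng[OF r]] by auto
  qed
qed

end

section \<open>The multiplier algebra and the Cauchy-Schwarz inequality\<close>

definition self_module :: "'a cstar_struct \<Rightarrow> ('a, 'a) hmod_struct" where
  "self_module A = \<lparr>ecarrier = acarrier A, escale = ascale A, eact = amult A, einner = (\<lambda>a b. astar A a \<odot>\<^bsub>A\<^esub> b)\<rparr>"

lemma self_module_simps [simp]:
  "ecarrier (self_module A) = acarrier A" "escale (self_module A) = ascale A" "eact (self_module A) = amult A"
  "einner (self_module A) a b = astar A a \<odot>\<^bsub>A\<^esub> b"
  by (simp_all add: self_module_def)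

context cstar_algebra
begin

lemma enorm_self_module: "a \<in> acarrier A \<Longrightarrow> enorm A (self_module A) a = anorm A a"
  by (simp add: enorm_def cstar_identity norm_nonneg)

text \<open>The module norm is the given norm, and Cauchy-Schwarz is submultiplicativity together
  with the isometry of the star.\<close>

lemma cauchy_schwarz_self_module: "cauchy_schwarz_module A (self_module A)"
proof (intro cauchy_schwarz_module.intro cauchy_schwarz_module_axioms.intro hilbert_module.intro hilbert_module_axioms.intro)
  show "norm_complete (ecarrier (self_module A)) (enorm A (self_module A))"
    unfolding norm_complete_def
  proof (intro allI impI, elim conjE)
    fix f :: "nat \<Rightarrow> 'a"
    assume f: "range f \<subseteq> ecarrier (self_module A)"
      and cauchy: "\<forall>\<epsilon>>0. \<exists>N. \<forall>m\<ge>N. \<forall>n\<ge>N. enorm A (self_module A) (f m - f n) < \<epsilon>"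
    have fc: "f n \<in> acarrier A" for n using f by auto
    have "\<forall>\<epsilon>>0. \<exists>N. \<forall>m\<ge>N. \<forall>n\<ge>N. anorm A (f m - f n) < \<epsilon>"
      using cauchy fc by (simp add: enorm_self_module)
    then obtain x where "x \<in> acarrier A" "(\<lambda>n. anorm A (f n - x)) \<longlonglongrightarrow> 0"
      using complete fc unfolding norm_complete_def by (metis image_subsetI)
    then show "\<exists>x\<in>ecarrier (self_module A). (\<lambda>n. enorm A (self_module A) (f n - x)) \<longlonglongrightarrow> 0"
      using fc by (intro bexI[of _ x]) (simp_all add: enorm_self_module)
  qed
  show "cstar_algebra A" by (rule cstar_algebra_axioms)
  show "vector_space (escale (self_module A))" by (simp add: vector_space_axioms)
  show "module.subspace (escale (self_module A)) (ecarrier (self_module A))" by (simp add: carrier_subspace)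
  fix x y
  assume x: "x \<in> ecarrier (self_module A)"
  show "positive A (einner (self_module A) x x)" using x by (auto simp: positive_def)
  show "x = 0" if "einner (self_module A) x x = 0" using x that star_mult_eq_0 by simp
  assume y: "y \<in> ecarrier (self_module A)"
  show "anorm A (einner (self_module A) x y) \<le> enorm A (self_module A) x * enorm A (self_module A) y"
    using x y norm_mult[of "astar A x" y] by (simp add: enorm_self_module norm_star)
qed (simp_all add: distribs star_simps)

section \<open>The isometric embedding into the multiplier algebra\<close>

abbreviation (input) multiplier_algebra :: "('a \<Rightarrow> 'a) cstar_struct" where
  "multiplier_algebra \<equiv> adjointable_algebra A (self_module A)"

definition left_mult :: "'a \<Rightarrow> 'a \<Rightarrow> 'a" where
  "left_mult a x = (if x \<in> acarrier A then a \<odot> x else 0)"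

interpretation S: cauchy_schwarz_module A "self_module A"
  by (rule cauchy_schwarz_self_module)

interpretation M: unital_cstar_algebra multiplier_algebra S.one_op
  by (rule S.adjointable_algebra_unital)

lemma adjoint_pair_left_mult:
  "a \<in> acarrier A \<Longrightarrow> adjoint_pair (self_module A) id (left_mult a) (left_mult (astar A a))"
  by (auto simp: adjoint_pair_def carrier_maps_def left_mult_def star_simps distribs)

lemma left_mult_closed [simp]: "a \<in> acarrier A \<Longrightarrow> left_mult a \<in> acarrier multiplier_algebra"
  unfolding S.acarrier_adjointable using adjoint_pair_left_mult by blast

lemma left_mult_star: "a \<in> acarrier A \<Longrightarrow> astar multiplier_algebra (left_mult a) = left_mult (astar A a)"
  by (rule S.astar_adjointable[OF adjoint_pair_left_mult])

lemma left_mult_mult: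
  "\<lbrakk>a \<in> acarrier A; b \<in> acarrier A\<rbrakk> \<Longrightarrow> left_mult (a \<odot> b) = left_mult a \<odot>\<^bsub>multiplier_algebra\<^esub> left_mult b"
  unfolding S.adjointable_algebra_simps by (auto simp: left_mult_def distribs)

lemma left_mult_add:
  "\<lbrakk>a \<in> acarrier A; b \<in> acarrier A\<rbrakk> \<Longrightarrow> left_mult (a + b) = left_mult a + left_mult b"
  by (auto simp: left_mult_def distribs)

lemma left_mult_diff:
  "\<lbrakk>a \<in> acarrier A; b \<in> acarrier A\<rbrakk> \<Longrightarrow> left_mult (a - b) = left_mult a - left_mult b"
  by (auto simp: left_mult_def distribs)

lemma left_mult_scale:
  "a \<in> acarrier A \<Longrightarrow> left_mult (ascale A c a) = ascale multiplier_algebra c (left_mult a)"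
  unfolding S.adjointable_algebra_simps by (auto simp: left_mult_def distribs)

text \<open>The lower bound comes from the test vector \<open>a\<^sup>*\<close>, as
  \<open>\<parallel>a a\<^sup>*\<parallel> = \<parallel>a\<parallel>\<^sup>2\<close>.\<close>

lemma left_mult_norm:
  assumes a: "a \<in> acarrier A" shows "anorm multiplier_algebra (left_mult a) = anorm A a"
proof -
  interpret twisted_module A "self_module A" id id by (rule S.twisted_id)
  note p = adjoint_pair_left_mult[OF a]
  have "op_norm A (self_module A) (left_mult a) \<le> anorm A a"
    by (rule op_norm_le) (use a in \<open>auto simp: left_mult_def enorm_self_module norm_nonneg norm_mult\<close>)
  moreover have "anorm A a \<le> op_norm A (self_module A) (left_mult a)"
  proof (cases "anorm A a = 0")
    case True
    then show ?thesis using op_norm_nonneg[OF p] by simp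
  next
    case False
    then have pos: "anorm A a > 0" using norm_nonneg[OF a] by simp
    have "anorm A (a \<odot> astar A a) = (anorm A a)\<^sup>2"
      using cstar_identity[of "astar A a"] a by (simp add: star_simps norm_star)
    then have "anorm A a * anorm A a \<le> op_norm A (self_module A) (left_mult a) * anorm A a"
      using op_norm_bound[OF p, of "astar A a"] a
      by (simp add: left_mult_def enorm_self_module norm_star power2_eq_square)
    then show ?thesis using pos by simp
  qed
  ultimately show ?thesis unfolding S.adjointable_algebra_simps by simp
qed

lemma left_mult_positive:
  assumes "positive A a" shows "M.nonneg (left_mult a)"
proof -
  obtain b where b: "b \<in> acarrier A" "a = astar A b \<odot> b" using assms unfolding positive_def by blast
  then show ?thesis using M.nonneg_star_mult[of "left_mult b"] by (simp add: left_mult_mult left_mult_star)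
qed

lemma positive_antisym:
  assumes "a \<in> acarrier A" "positive A a" "positive A (- a)" shows "a = 0"
proof -
  have "left_mult (- a) = - left_mult a" using left_mult_diff[of 0 a] assms(1) left_mult_diff[of 0 0] by simp
  then have "left_mult a = 0" using M.nonneg_antisym left_mult_positive assms(2,3) by metis
  then show ?thesis using left_mult_norm[OF assms(1)] norm_eq_zero_iff[OF assms(1)] by simp
qed

text \<open>This is \<open>b\<^sup>* e b \<le> t b\<^sup>* b\<close>. In the multiplier algebra
  \<open>t 1 - e = k k\<close>, and the difference of the two sides is \<open>c\<^sup>* c\<close>
  for \<open>c = k b\<close>.\<close>

lemma nonneg_conj_bound:
  assumes e: "e \<in> acarrier A" "astar A e = e" "anorm A e \<le> t" "t > 0" and b: "b \<in> acarrier A"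
  shows "M.nonneg (left_mult (ascale A (of_real t) (astar A b \<odot> b) - astar A b \<odot> (e \<odot> b)))"
proof -
  let ?M = multiplier_algebra
  have "M.nonneg (ascale ?M (of_real t) S.one_op - left_mult e)"
    by (rule M.nonneg_scale_one_minus) (use e in \<open>auto simp: left_mult_star left_mult_norm\<close>)
  then obtain k where k: "k \<in> acarrier ?M" "astar ?M k = k" "k \<odot>\<^bsub>?M\<^esub> k = ascale ?M (of_real t) S.one_op - left_mult e"
    unfolding M.nonneg_def by metis
  let ?c = "k \<odot>\<^bsub>?M\<^esub> left_mult b"
  have "astar ?M ?c \<odot>\<^bsub>?M\<^esub> ?c = left_mult (astar A b) \<odot>\<^bsub>?M\<^esub> ((k \<odot>\<^bsub>?M\<^esub> k) \<odot>\<^bsub>?M\<^esub> left_mult b)"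
    using k(1,2) b by (simp add: M.star_simps M.mult_assoc left_mult_star)
  also have "\<dots> = left_mult (ascale A (of_real t) (astar A b \<odot> b) - astar A b \<odot> (e \<odot> b))"
    unfolding k(3) using b e by (simp add: M.distribs left_mult_mult left_mult_diff left_mult_scale)
  finally show ?thesis using M.nonneg_star_mult[of ?c] k b by simp
qed

text \<open>
  If \<open>h = a\<^sup>*a\<close> has norm at most 1, then \<open>1 - h = (1 - w)\<^sup>2\<close> with \<open>w \<in> A\<close>. Applying \<open>\<sharp>\<close> shows that \<open>1 - h\<^sup>\<sharp>\<close> is a
  square as well, so that \<open>h\<^sup>\<sharp>\<close> has norm at most 1.
\<close>
lemma star_conj_automorphism_contractive:
  assumes s: "star_conj_automorphism A s" and a: "a \<in> acarrier A" "anorm A a \<le> 1"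
  shows "anorm A (s a) \<le> 1"
proof -
  let ?M = multiplier_algebra
  have sc [simp]: "\<And>x. x \<in> acarrier A \<Longrightarrow> s x \<in> acarrier A"
    and s_star: "\<And>x. x \<in> acarrier A \<Longrightarrow> astar A (s x) = s (astar A x)"
    and s_mult: "\<And>x y. x \<in> acarrier A \<Longrightarrow> y \<in> acarrier A \<Longrightarrow> s (x \<odot> y) = s x \<odot> s y"
    using s unfolding star_conj_automorphism_def by blast+
  have s_add: "s (x + y) = s x + s y" if "x \<in> acarrier A" "y \<in> acarrier A" for x y
  proof -
    have "s (ascale A 1 x + y) = ascale A (cnj 1) (s x) + s y"
      using s that unfolding star_conj_automorphism_def by blast
    then show ?thesis by simp
  qed
  define h where "h = astar A a \<odot> a"
  have h: "h \<in> acarrier A" "astar A h = h" "anorm A h \<le> 1"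
    unfolding h_def using a norm_nonneg[of a] by (auto simp: star_simps cstar_identity power_le_one)
  obtain w where w: "w \<in> acarrier A" "astar A w = w" "w + w = h + w \<odot> w"
    by (rule sqrt_one_minus[OF h])
  \<comment> \<open>\<open>s\<close> acts on \<open>A\<close> but not on the unit adjoined by the
    multiplier algebra, so the root of \<open>1 - h\<close> is transported through the quadratic
    equation for \<open>w\<close>.\<close>
  have sw: "s w + s w = s h + s w \<odot> s w"
  proof -
    have "s w + s w = s (w + w)" using w(1) by (simp add: s_add)
    also have "\<dots> = s h + s w \<odot> s w" unfolding w(3) using w(1) h(1) by (simp add: s_add s_mult)
    finally show ?thesis .
  qed
  let ?v = "S.one_op - left_mult (s w)"
  have "?v \<odot>\<^bsub>?M\<^esub> ?v = S.one_op - left_mult (s w + s w) + left_mult (s w \<odot> s w)"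
    using w by (simp add: M.distribs left_mult_add left_mult_mult)
  also have "\<dots> = S.one_op - left_mult (s h)"
    unfolding sw using w h by (simp add: left_mult_add)
  finally have v: "?v \<odot>\<^bsub>?M\<^esub> ?v = S.one_op - left_mult (s h)" .
  have "M.nonneg (S.one_op - left_mult (s h))"
    by (rule M.nonnegI[of ?v]) (use w v in \<open>auto simp: M.star_simps left_mult_star s_star\<close>)
  moreover have sh: "s h = astar A (s a) \<odot> s a"
    unfolding h_def using a by (simp add: s_star s_mult)
  then have "positive A (s h)" unfolding positive_def using a by auto
  then have "M.nonneg (left_mult (s h))" by (rule left_mult_positive)
  ultimately have "anorm A (s h) \<le> 1"
    using M.norm_le_one_if_nonneg[of "left_mult (s h)"] left_mult_norm[of "s h"] h by simp
  then have "(anorm A (s a))\<^sup>2 \<le> 1" using cstar_identity[of "s a"] a by (simp add: sh)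
  then show ?thesis using norm_nonneg[of "s a"] a by (simp add: power_le_one_iff abs_le_square_iff)
qed

text \<open>Scaling by a real number, which conjugation fixes, extends contractivity from the unit
  ball; as \<open>s\<close> is an involution, the bound also holds backwards.\<close>

lemma star_conj_automorphism_norm:
  assumes s: "star_conj_automorphism A s" and a: "a \<in> acarrier A"
  shows "anorm A (s a) = anorm A a"
proof -
  have sc [simp]: "\<And>x. x \<in> acarrier A \<Longrightarrow> s x \<in> acarrier A" and ss: "\<And>x. x \<in> acarrier A \<Longrightarrow> s (s x) = x"
    and s_lin: "\<And>x y c. x \<in> acarrier A \<Longrightarrow> y \<in> acarrier A \<Longrightarrow> s (ascale A c x + y) = ascale A (cnj c) (s x) + s y"
    using s unfolding star_conj_automorphism_def by blast+
  have s0: "s 0 = 0" using s_lin[of 0 0 1] by simp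
  have le: "anorm A (s b) \<le> anorm A b" if b: "b \<in> acarrier A" for b
  proof (cases "b = 0")
    case False
    then have pos: "anorm A b > 0" using norm_nonneg[OF b] norm_eq_zero_iff[OF b] by linarith
    let ?k = "complex_of_real (1 / anorm A b)"
    have k: "cmod ?k = 1 / anorm A b" using pos by (simp add: norm_divide)
    have "anorm A (ascale A ?k b) \<le> 1" using pos by (simp only: norm_scale[OF b] k) simp
    then have "anorm A (s (ascale A ?k b)) \<le> 1" using star_conj_automorphism_contractive[OF s] b by simp
    also have "s (ascale A ?k b) = ascale A ?k (s b)" using s_lin[of b 0 ?k] b s0 by simp
    finally have "1 / anorm A b * anorm A (s b) \<le> 1" using b by (simp only: norm_scale[OF sc[OF b]] k)
    then show ?thesis using pos by (simp add: field_simps)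
  qed (simp add: s0)
  show ?thesis using le[of a] le[of "s a"] a by (simp add: ss)
qed

end

text \<open>With \<open>e = \<langle>x, x\<rangle>\<close>,
  \<open>b = \<langle>x, y\<rangle>\<close> and \<open>t = \<parallel>e\<parallel>\<close>, expand
  \<open>\<langle>z, z\<rangle> \<ge> 0\<close> for \<open>z = t y - x b\<close> and estimate
  \<open>b\<^sup>* e b \<le> t b\<^sup>* b\<close>. This leaves
  \<open>t b\<^sup>* b \<le> t\<^sup>2 \<langle>y, y\<rangle>\<close> in the multiplier algebra,
  where norms are monotone.\<close>

theorem (in hilbert_module) cauchy_schwarz_inequality:
  assumes x: "x \<in> ecarrier E" and y: "y \<in> ecarrier E"
  shows "anorm A (einner E x y) \<le> enorm A E x * enorm A E y"
proof (cases "x = 0")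
  case True
  then show ?thesis using y by simp
next
  case False
  interpret S: cauchy_schwarz_module A "self_module A" by (rule cauchy_schwarz_self_module)
  interpret M: unital_cstar_algebra multiplier_algebra S.one_op by (rule S.adjointable_algebra_unital)
  let ?M = multiplier_algebra
  define e where "e = einner E x x"
  define b where "b = einner E x y"
  define t where "t = anorm A e"
  have e: "e \<in> acarrier A" "astar A e = e" unfolding e_def using x inner_commute[of x x] by auto
  have b: "b \<in> acarrier A" "einner E y x = astar A b" unfolding b_def using x y inner_commute[of x y] by auto
  have t: "t > 0" unfolding t_def e_def
    using norm_nonneg[of "einner E x x"] norm_eq_zero_iff[of "einner E x x"] inner_eq_zero[of x] x False
    by (auto simp: less_le)
  let ?bb = "astar A b \<odot> b" and ?yy = "einner E y y" and ?t = "complex_of_real t"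
  let ?z = "escale E ?t y - eact E x b"
  let ?u = "ascale A ?t ?bb - astar A b \<odot> (e \<odot> b)"
  have "M.nonneg (left_mult (einner E ?z ?z))"
    by (rule left_mult_positive[OF inner_positive]) (use x y b in auto)
  moreover have "M.nonneg (left_mult ?u)"
    by (rule nonneg_conj_bound) (use e b t in \<open>auto simp: t_def\<close>)
  ultimately have "M.nonneg (left_mult (einner E ?z ?z) + left_mult ?u)" by (rule M.nonneg_add)
  also have "einner E ?z ?z = ascale A ?t (ascale A ?t ?yy) - ascale A ?t ?bb - ascale A ?t ?bb + astar A b \<odot> (e \<odot> b)"
    using x y b e by (simp add: inner_diff_left inner_diff_right inner_scale_left inner_scale_right inner_act_left
        inner_act_right distribs b_def[symmetric] e_def[symmetric] algebra_simps)
  also have "left_mult \<dots> + left_mult ?u = left_mult (ascale A ?t (ascale A ?t ?yy)) - left_mult (ascale A ?t ?bb)"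
    using x y b e by (simp add: left_mult_add left_mult_diff)
  finally have "M.nonneg (left_mult (ascale A ?t (ascale A ?t ?yy)) - left_mult (ascale A ?t ?bb))" .
  moreover have "M.nonneg (left_mult (ascale A ?t ?bb))"
  proof -
    have "M.nonneg (left_mult ?bb)" by (rule left_mult_positive) (use b in \<open>auto simp: positive_def\<close>)
    then have "M.nonneg (ascale ?M ?t (left_mult ?bb))" using t by (intro M.nonneg_scale) auto
    then show ?thesis using b by (simp add: left_mult_scale)
  qed
  ultimately have "anorm ?M (left_mult (ascale A ?t ?bb)) \<le> anorm ?M (left_mult (ascale A ?t (ascale A ?t ?yy)))"
    by (intro M.norm_mono)
  then have "t * (anorm A b)\<^sup>2 \<le> t * (t * anorm A ?yy)"
    using b y t by (simp add: left_mult_norm norm_scale cstar_identity del: scale_scale)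
  then have "(anorm A b)\<^sup>2 \<le> (enorm A E x * enorm A E y)\<^sup>2"
    using t x y by (simp add: power_mult_distrib enorm_squared t_def e_def)
  then show ?thesis unfolding b_def
    by (rule power2_le_imp_le) (use x y enorm_nonneg in auto)
qed

section \<open>The module of \<open>\<sharp>\<close>-adjointable operators\<close>

context cauchy_schwarz_module
begin

context
  fixes sharp :: "'a \<Rightarrow> 'a"
  assumes sharp: "star_conj_automorphism A sharp"
begin

lemma twisted_sharp: "twisted_module A E sharp cnj"
proof
  have lin: "sharp (ascale A c a + b) = ascale A (cnj c) (sharp a) + sharp b" if "a \<in> acarrier A" "b \<in> acarrier A" for a b c
    using sharp that unfolding star_conj_automorphism_def by blast
  have zero: "sharp 0 = 0" using lin[of 0 0 1] by simp
  fix a b c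
  assume a: "a \<in> acarrier A"
  show "sharp a \<in> acarrier A" "sharp (sharp a) = a" "astar A (sharp a) = sharp (astar A a)"
    using sharp a unfolding star_conj_automorphism_def by blast+
  show "sharp (ascale A c a) = ascale A (cnj c) (sharp a)" using lin[of a 0 c] a zero by simp
  show "anorm A (sharp a) = anorm A a" by (rule star_conj_automorphism_norm[OF sharp a])
  assume "b \<in> acarrier A"
  then show "sharp (a + b) = sharp a + sharp b" using lin[of a b 1] a by simp
qed auto

interpretation L: twisted_module A E id id by (rule twisted_id)

interpretation C: twisted_module A E sharp cnj by (rule twisted_sharp)

interpretation B: unital_cstar_algebra "adjointable_algebra A E" one_op
  by (rule adjointable_algebra_unital)

lemma sharp_adjoint_pair_iff: "adjoint_pair E sharp T R \<longleftrightarrow>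
    T \<in> conj_linear_ops E \<and> bounded_op A E T \<and> is_sharp_adjoint A sharp E T R"
proof
  assume p: "adjoint_pair E sharp T R"
  have "bounded_op A E T" "bounded_op A E R"
    unfolding bounded_op_def using C.adjoint_pair_bounded[OF p] C.adjoint_pair_bounded[OF C.adjoint_pair_sym[OF p]]
    by blast+
  moreover have "T \<in> conj_linear_ops E" "R \<in> conj_linear_ops E"
    unfolding conj_linear_ops_def
    using C.adjoint_pair_semilinear[OF p] C.adjoint_pair_semilinear[OF C.adjoint_pair_sym[OF p]]
      adjoint_pair_maps[OF p] by blast+
  ultimately show "T \<in> conj_linear_ops E \<and> bounded_op A E T \<and> is_sharp_adjoint A sharp E T R"
    using adjoint_pairD[OF p] unfolding is_sharp_adjoint_def by blast
qed (auto simp: conj_linear_ops_def is_sharp_adjoint_def adjoint_pair_def)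

lemma ecarrier_sharp: "ecarrier (sharp_adjointable_module A sharp E) = {T. \<exists>R. adjoint_pair E sharp T R}"
  unfolding sharp_adjoint_pair_iff by (auto simp: sharp_adjointable_module_def)

lemma einner_sharp:
  assumes p: "adjoint_pair E sharp S R"
  shows "einner (sharp_adjointable_module A sharp E) S T = R \<circ> T"
proof -
  have "is_sharp_adjoint A sharp E S R' \<longleftrightarrow> adjoint_pair E sharp S R'" for R'
    using p unfolding sharp_adjoint_pair_iff by blast
  then have "(THE R. is_sharp_adjoint A sharp E S R) = R"
    using p C.adjoint_pair_unique[OF p] by (intro the_equality) blast+
  then show ?thesis by (simp add: sharp_adjointable_module_def)
qed

lemma sharp_module_simps:
  "escale (sharp_adjointable_module A sharp E) = (\<lambda>c T x. escale E (cnj c) (T x))"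
  "eact (sharp_adjointable_module A sharp E) = (\<circ>)"
  by (simp_all add: sharp_adjointable_module_def)

text \<open>The two conjugations cancel. This yields both that inner products lie in the algebra and
  that they are hermitian, as \<open>T\<^sup>* S\<close> and \<open>S\<^sup>* T\<close> are adjoint
  to each other.\<close>

lemma adjoint_pair_sharp_sharp:
  assumes p: "adjoint_pair E sharp T R" and q: "adjoint_pair E sharp S Q"
  shows "adjoint_pair E id (R \<circ> S) (Q \<circ> T)"
proof (rule adjoint_pair_cong[OF hilbert_module_axioms])
  show "adjoint_pair E (sharp \<circ> sharp) (R \<circ> S) (Q \<circ> T)"
    using C.adjoint_pair_map_zero p q C.adjoint_pair_sym by (blast intro: adjoint_pair_comp)
qed (simp add: C.s_s)

lemma adjoint_pair_sharp_id:
  assumes p: "adjoint_pair E sharp T R" and q: "adjoint_pair E id S Q"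
  shows "adjoint_pair E sharp (T \<circ> S) (Q \<circ> R)"
  using adjoint_pair_comp[OF p C.adjoint_pair_map_zero[OF p] q L.adjoint_pair_map_zero[OF L.adjoint_pair_sym[OF q]]]
  by simp

text \<open>
  For \<open>P = T\<^sup>*T\<close> one has \<open>\<langle>x, P x\<rangle> = \<langle>T x, T x\<rangle>\<^sup>\<sharp> \<ge> 0\<close>, which on the range of the negative part of \<open>P\<close>
  forces that part to vanish; so \<open>P\<close> is the square of a self-adjoint operator.
\<close>
lemma positive_sharp_adjoint_comp:
  assumes p: "adjoint_pair E sharp T R"
  shows "positive (adjointable_algebra A E) (R \<circ> T)"
proof -
  let ?B = "adjointable_algebra A E" and ?P = "R \<circ> T"
  note comp = adjointable_algebra_simps(2)
  have P: "adjoint_pair E id ?P ?P" by (rule adjoint_pair_sharp_sharp[OF p p])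
  then have "?P \<in> acarrier ?B" "astar ?B ?P = ?P" using acarrier_adjointable astar_adjointable by blast+
  then obtain m d where m: "m \<in> acarrier ?B" "astar ?B m = m" and d: "d \<in> acarrier ?B" "astar ?B d = d"
    and md: "m \<circ> d = d \<circ> m" and dPd: "d \<circ> (?P \<circ> d) = - ((m \<circ> d) \<circ> (m \<circ> d))"
    and eq: "m \<circ> d = 0 \<Longrightarrow> ?P = m \<circ> m"
    by (rule B.negative_part[unfolded comp]) (rule that)
  have pair: "adjoint_pair E id T' T'" if "T' \<in> acarrier ?B" "astar ?B T' = T'" for T'
    using that acarrier_adjointable astar_adjointable by fastforce
  have md_pair: "adjoint_pair E id (m \<circ> d) (m \<circ> d)"
    by (rule pair) (use m d md B.mult_closed[of m d] B.star_mult[of m d] in \<open>simp_all add: comp\<close>)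
  note d_pair = pair[OF d]
  have "m \<circ> d = 0"
  proof (rule carrier_maps_eqI[OF adjoint_pair_maps(1)[OF md_pair]])
    fix y assume y: "y \<in> ecarrier E"
    let ?u = "(m \<circ> d) y"
    note dy = adjoint_pair_closed(1)[OF d_pair y]
    note Tdy = adjoint_pair_closed(1)[OF p dy]
    note u = adjoint_pair_closed(1)[OF md_pair y] adjoint_pair_closed(1)[OF md_pair adjoint_pair_closed(1)[OF md_pair y]]
    have "einner E y (d (?P (d y))) = einner E (d y) (?P (d y))"
      using adjoint_pairD[OF d_pair y] adjoint_pair_closed(1)[OF P dy] by simp
    also have "\<dots> = sharp (sharp (einner E (d y) (R (T (d y)))))"
      using C.s_s[OF inner_closed[OF dy adjoint_pair_closed(2)[OF p Tdy]]] by simp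
    also have "\<dots> = sharp (einner E (T (d y)) (T (d y)))" using adjoint_pairD[OF p dy Tdy] by simp
    finally have dPdy: "einner E y (d (?P (d y))) = sharp (einner E (T (d y)) (T (d y)))" .
    \<comment> \<open>The same element, evaluated through \<open>d P d = - (m d) (m d)\<close> and
      the self-adjointness of \<open>m d\<close>, is \<open>- \<langle>u, u\<rangle>\<close>. So
      \<open>\<langle>u, u\<rangle>\<close> and its negative are both positive.\<close>
    have "einner E y (d (?P (d y))) = einner E y (- ((m \<circ> d) ?u))"
      using fun_cong[OF dPd, of y] by simp
    also have "\<dots> = - einner E y ((m \<circ> d) ?u)"
      using inner_diff_right[OF y E_closed(1) u(2)] y by simp
    also have "einner E y ((m \<circ> d) ?u) = einner E ?u ?u"
      using adjoint_pairD[OF md_pair y u(1)] by simp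
    finally have "- einner E ?u ?u = sharp (einner E (T (d y)) (T (d y)))" using dPdy by simp
    \<comment> \<open>Being multiplicative and compatible with the star, \<sharp> sends
      \<open>b\<^sup>* b\<close> to an element of the same form.\<close>
    moreover have "positive A (sharp (einner E (T (d y)) (T (d y))))"
    proof -
      obtain b where b: "b \<in> acarrier A" "einner E (T (d y)) (T (d y)) = astar A b \<odot> b"
        using inner_positive[OF Tdy] unfolding positive_def by blast
      then have "sharp (astar A b \<odot> b) = astar A (sharp b) \<odot> sharp b"
        using sharp unfolding star_conj_automorphism_def by simp
      then show ?thesis using b unfolding positive_def by auto
    qed
    ultimately have "einner E ?u ?u = 0"
      using positive_antisym[of "einner E ?u ?u"] inner_positive[OF u(1)] u(1) by simp
    then show "?u = 0 y" using inner_eq_zero[OF u(1)] by simp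
  qed (simp add: carrier_maps_def)
  then show ?thesis unfolding positive_def comp using eq m by (intro bexI[of _ m]) simp_all
qed

lemma enorm_sharp:
  assumes p: "adjoint_pair E sharp T R"
  shows "enorm (adjointable_algebra A E) (sharp_adjointable_module A sharp E) T = op_norm A E T"
  using C.op_norm_adjoint_comp[OF p] C.op_norm_nonneg[OF p]
  by (simp add: enorm_def einner_sharp[OF p] adjointable_algebra_simps)

theorem sharp_adjointable_hilbert_module:
  "hilbert_module (adjointable_algebra A E) (sharp_adjointable_module A sharp E)"
proof -
  let ?B = "adjointable_algebra A E" and ?F = "sharp_adjointable_module A sharp E"
  interpret V: vector_space "\<lambda>c (T :: 'e \<Rightarrow> 'e) x. escale E c (T x)" by (rule vector_space_pointwise)
  interpret F: vector_space "\<lambda>c (T :: 'e \<Rightarrow> 'e) x. escale E (cnj c) (T x)"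
    by unfold_locales (auto simp: fun_eq_iff E.scale_right_distrib E.scale_left_distrib)
  note simps = acarrier_adjointable adjointable_algebra_simps ecarrier_sharp sharp_module_simps
  have rng: "T x \<in> ecarrier E" if "adjoint_pair E s T R" for s T R x
    using carrier_maps_range adjoint_pair_maps(1)[OF that] by blast
  have complete: "norm_complete (ecarrier ?F) (enorm ?B ?F)"
    unfolding norm_complete_def
  proof (intro allI impI, elim conjE)
    fix f :: "nat \<Rightarrow> 'e \<Rightarrow> 'e"
    assume f: "range f \<subseteq> ecarrier ?F" and cauchy: "\<forall>\<epsilon>>0. \<exists>N. \<forall>m\<ge>N. \<forall>n\<ge>N. enorm ?B ?F (f m - f n) < \<epsilon>"
    have fn: "\<exists>R. adjoint_pair E sharp (f n) R" for n using f unfolding ecarrier_sharp by blast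
    have diff: "enorm ?B ?F (f n - g) = op_norm A E (f n - g)" if "\<exists>R. adjoint_pair E sharp g R" for n g
      using fn[of n] that C.adjoint_pair_diff enorm_sharp by blast
    have "\<forall>\<epsilon>>0. \<exists>N. \<forall>m\<ge>N. \<forall>n\<ge>N. op_norm A E (f m - f n) < \<epsilon>"
      using cauchy diff[OF fn] by simp
    then obtain g where g: "\<exists>R. adjoint_pair E sharp g R" "(\<lambda>n. op_norm A E (f n - g)) \<longlonglongrightarrow> 0"
      using C.op_norm_complete f unfolding norm_complete_def ecarrier_sharp by blast
    then show "\<exists>g\<in>ecarrier ?F. (\<lambda>n. enorm ?B ?F (f n - g)) \<longlonglongrightarrow> 0"
      unfolding ecarrier_sharp by (intro bexI[of _ g]) (simp_all add: diff[OF g(1)])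
  qed
  show ?thesis
  proof (intro hilbert_module.intro hilbert_module_axioms.intro)
    show "cstar_algebra ?B" by (rule B.cstar_algebra_axioms)
    show "vector_space (escale ?F)" unfolding simps by (rule F.vector_space_axioms)
    show "module.subspace (escale ?F) (ecarrier ?F)"
      unfolding simps F.subspace_def
      using C.adjoint_pair_zero C.adjoint_pair_add C.adjoint_pair_scale by blast
    show "norm_complete (ecarrier ?F) (enorm ?B ?F)" by (rule complete)
  next
    fix T U V c assume "T \<in> ecarrier ?F" "U \<in> acarrier ?B"
    then obtain R Q where p: "adjoint_pair E sharp T R" and q: "adjoint_pair E id U Q" unfolding simps by blast
    show "eact ?F T U \<in> ecarrier ?F" unfolding simps using adjoint_pair_sharp_id[OF p q] by blast
    show "eact ?F (escale ?F c T) U = escale ?F c (eact ?F T U)" unfolding simps by auto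
    \<comment> \<open>The conjugate-linear \<open>T\<close> turns \<open>c\<close> into
      \<open>cnj c\<close>, which is the module's scalar multiplication by \<open>c\<close>.\<close>
    show "eact ?F T (ascale ?B c U) = escale ?F c (eact ?F T U)"
      unfolding simps using C.adjoint_pair_map_scale[OF p rng[OF q]] by auto
    assume "V \<in> acarrier ?B"
    then obtain W where r: "adjoint_pair E id V W" unfolding simps by blast
    show "eact ?F T (U + V) = eact ?F T U + eact ?F T V"
      unfolding simps using C.adjoint_pair_map_add[OF p rng[OF q] rng[OF r]] by auto
    show "eact ?F T (U \<odot>\<^bsub>?B\<^esub> V) = eact ?F (eact ?F T U) V" unfolding simps by (simp add: o_assoc)
  next
    fix S T c assume "S \<in> ecarrier ?F" "T \<in> ecarrier ?F"
    then obtain Q R where p: "adjoint_pair E sharp S Q" and q: "adjoint_pair E sharp T R" unfolding simps by blast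
    show "einner ?F S T \<in> acarrier ?B"
      unfolding simps einner_sharp[OF p] using adjoint_pair_sharp_sharp[OF p q] by blast
    \<comment> \<open>The conjugation built into the scalar multiplication is undone by the
      conjugate-linear adjoint of \<open>S\<close>.\<close>
    show "einner ?F S (escale ?F c T) = ascale ?B c (einner ?F S T)"
      unfolding simps einner_sharp[OF p] using C.adjoint_pair_map_scale[OF C.adjoint_pair_sym[OF p] rng[OF q]] by auto
    show "einner ?F T S = astar ?B (einner ?F S T)"
      unfolding einner_sharp[OF p] einner_sharp[OF q]
      by (rule astar_adjointable[OF adjoint_pair_sharp_sharp[OF p q], symmetric])
    fix U
    show "eact ?F (S + T) U = eact ?F S U + eact ?F T U" unfolding simps by auto
    show "einner ?F S (eact ?F T U) = einner ?F S T \<odot>\<^bsub>?B\<^esub> U" unfolding simps einner_sharp[OF p] by (simp add: o_assoc)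
    assume "U \<in> ecarrier ?F"
    then obtain W where r: "adjoint_pair E sharp U W" unfolding simps by blast
    show "einner ?F S (T + U) = einner ?F S T + einner ?F S U"
      unfolding einner_sharp[OF p] using C.adjoint_pair_map_add[OF C.adjoint_pair_sym[OF p] rng[OF q] rng[OF r]] by auto
  next
    fix T assume "T \<in> ecarrier ?F"
    then obtain R where p: "adjoint_pair E sharp T R" unfolding simps by blast
    show "positive ?B (einner ?F T T)" unfolding einner_sharp[OF p] by (rule positive_sharp_adjoint_comp[OF p])
    assume "einner ?F T T = 0"
    then have "op_norm A E T = 0"
      using C.op_norm_adjoint_comp[OF p] L.op_norm_zero unfolding einner_sharp[OF p] by simp
    then show "T = 0" using C.op_norm_eq_0_iff[OF p] by blast
  qed
qed

end

end

theorem mainTheorem4: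
  fixes A :: "'a::ab_group_add cstar_struct"
    and sharp :: "'a \<Rightarrow> 'a"
    and E :: "('a, 'e::ab_group_add) hmod_struct"
  assumes "cstar_algebra A"
    and "star_conj_automorphism A sharp"
    and "hilbert_module A E"
  shows "hilbert_module (adjointable_algebra A E) (sharp_adjointable_module A sharp E) \<and>
    (\<forall>T\<in>ecarrier (sharp_adjointable_module A sharp E).
       enorm (adjointable_algebra A E) (sharp_adjointable_module A sharp E) T = op_norm A E T)"
proof -
  interpret hilbert_module A E by (rule assms(3))
  interpret cauchy_schwarz_module A E by unfold_locales (rule cauchy_schwarz_inequality)
  show ?thesis
    using sharp_adjointable_hilbert_module[OF assms(2)] enorm_sharp[OF assms(2)] ecarrier_sharp[OF assms(2)]
    by blast
qed

end
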